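(* Let $\Gamma$ be a countably infinite group. For all $f \in L^1(\Omega, \boldsymbol{\lambda})$ and $\varepsilon > 0$, there exists $C > 0$ with the following property: whenever $(D_n)_{n \in \mathbb{N}}$ is a sequence of finite subsets of $\Gamma$ with $|D_n| \geq C \log(n+2)$ for all $n \in \mathbb{N}$, there exist $g, h \in L^1(\Omega, \boldsymbol{\lambda})$ such that $f = g + h$, $\|h\|_1 \leq \varepsilon$, and $\|g\|^{\mathrm{disc}}_{D_n} \leq \varepsilon$ for all $n \in \mathbb{N}$.
   Context: $\Omega = [0;1]^\Gamma$ and $\boldsymbol{\lambda} = \lambda^\Gamma$, where $\lambda$ is the Lebesgue probability measure on $[0;1]$. The group $\Gamma$ acts on $\Omega$ by the shift action $(\gamma \cdot x)(\delta) = x(\delta\gamma)$ for $x \in \Omega$, $\gamma,\delta \in \Gamma$; it preserves $\boldsymbol{\lambda}$. For $g \in L^1(\Omega,\boldsymbol{\lambda})$, $\mathbb{E}_{\boldsymbol{\lambda}} g = \int_\Omega g \, d\boldsymbol{\lambda}$, and for a nonempty finite $D \subset \Gamma$, $\mathbb{E}_D g(x) = \frac{1}{|D|}\sum_{\delta \in D} g(\delta \cdot x)$. The discrepancy norm of $g$ with respect to $D$ is $\|g\|^{\mathrm{disc}}_D = \|\mathbb{E}_D g - \mathbb{E}_{\boldsymbol{\lambda}} g\|_\infty$, where $\|\cdot\|_\infty$ is the norm of $L^\infty(\Omega, \boldsymbol{\lambda})$. Functions in $L^1$ are complex-valued; $\mathbb{N}$ includes $0$. *)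

theory Defs
  imports "HOL-Probability.Probability" "HOL-Algebra.Group"
begin

definition unit_interval_measure :: "real measure" where
  "unit_interval_measure = restrict_space lborel {0..1}"

text \<open>The space \<open>[0;1]\<^sup>\<Gamma>\<close> consists of functions that are extensional on
  \<open>carrier \<Gamma>\<close> (value \<open>undefined\<close> elsewhere), as usual for \<^const>\<open>PiM\<close>.\<close>

definition shift_measure :: "('a, 'b) monoid_scheme \<Rightarrow> ('a \<Rightarrow> real) measure" where
  "shift_measure \<Gamma> = PiM (carrier \<Gamma>) (\<lambda>_. unit_interval_measure)"

definition shift_act :: "('a, 'b) monoid_scheme \<Rightarrow> 'a \<Rightarrow> ('a \<Rightarrow> real) \<Rightarrow> ('a \<Rightarrow> real)" where
  "shift_act \<Gamma> \<gamma> x = (\<lambda>\<delta>\<in>carrier \<Gamma>. x (\<delta> \<otimes>\<^bsub>\<Gamma>\<^esub> \<gamma>))"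

definition shift_average ::
  "('a, 'b) monoid_scheme \<Rightarrow> 'a set \<Rightarrow> (('a \<Rightarrow> real) \<Rightarrow> complex) \<Rightarrow> ('a \<Rightarrow> real) \<Rightarrow> complex" where
  "shift_average \<Gamma> D g x = (\<Sum>\<delta>\<in>D. g (shift_act \<Gamma> \<delta> x)) / of_nat (card D)"

text \<open>The \<open>L\<^sup>\<infinity>\<close> norm is taken in the extended reals, since the discrepancy norm of an
  integrable function may be infinite.\<close>

definition disc_norm ::
  "('a, 'b) monoid_scheme \<Rightarrow> 'a set \<Rightarrow> (('a \<Rightarrow> real) \<Rightarrow> complex) \<Rightarrow> ereal" where
  "disc_norm \<Gamma> D g =
     esssup (shift_measure \<Gamma>)
       (\<lambda>x. ereal (cmod (shift_average \<Gamma> D g x - (LINT y|shift_measure \<Gamma>. g y))))"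

lemma prob_space_unit_interval_measure: "prob_space unit_interval_measure"
  unfolding unit_interval_measure_def
  by (rule prob_spaceI) (simp add: emeasure_restrict_space space_restrict_space)

lemma prob_space_shift_measure: "prob_space (shift_measure \<Gamma>)"
  unfolding shift_measure_def
  by (intro prob_space_PiM prob_space_unit_interval_measure)

lemma space_shift_measure: "space (shift_measure \<Gamma>) = (\<Pi>\<^sub>E \<delta>\<in>carrier \<Gamma>. {0..1})"
  by (simp add: shift_measure_def unit_interval_measure_def space_PiM space_restrict_space)

end

theory Submission
  imports Defs
begin

text \<open>By \<open>L\<^sup>1\<close> density it suffices to treat a bounded function \<open>f\<close> depending on finitely many coordinates.
  Let \<open>\<phi> = f - E f\<close>. Hoeffding's lemma shows that \<open>\<bar>\<Sum>\<delta>\<in>D n. \<phi> (\<delta> \<cdot> x)\<bar> > \<epsilon> |D n|\<close> has probability exponentially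
  small in \<open>|D n|\<close>. The exceptional \<open>x\<close> are repaired as in the Moser--Tardos algorithm, but without
  resampling: as long as some \<open>x\<close> is bad for \<open>D n\<close>, the value of \<open>\<phi>\<close> is reset to \<open>0\<close> at all points \<open>\<delta> \<cdot> x\<close>,
  \<open>\<delta> \<in> D n\<close>. Every point is reset at most once, so each finite sum stabilises, and in the limit no \<open>x\<close> is
  bad: a bad one would have been reset entirely, making its sum zero.

  The set \<open>R\<close> of reset points is small. The causal past of a reset is a sequence of layers of sets
  \<open>D m \<gamma>\<close>, each layer meeting the previous one, and the parts of these sets on which \<open>\<phi>\<close> was not yet reset
  are pairwise disjoint. Hence the probability of a given history is at most the product of the
  individual failure probabilities, and the sum over all histories is controlled as in the Local
  Lemma. The growth condition on \<open>|D n|\<close> makes \<open>\<Sum>n. |D n| exp (-c |D n| / 2)\<close> small, which is the Local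
  Lemma condition. Finally \<open>g\<close> is \<open>f\<close> with its values on \<open>R\<close> replaced by the mean.\<close>

section \<open>Colourings and series\<close>

text \<open>A vertex coloured last sees fewer than \<open>k\<close> colours, so one of the
  \<open>k\<close> colours is free for it. \<open>r\<close> may be reflexive: in the application it
  says that two translates of a finite set meet, so an element can count among its own
  neighbours.\<close>

lemma greedy_colouring:
  fixes r :: "'c \<Rightarrow> 'c \<Rightarrow> bool"
  assumes "finite Y" and sym: "\<And>a b. r a b \<Longrightarrow> r b a"
    and deg: "\<And>a. a \<in> Y \<Longrightarrow> card {b \<in> Y. r a b} < k"
  shows "\<exists>c. (\<forall>a\<in>Y. c a < k) \<and> (\<forall>a\<in>Y. \<forall>b\<in>Y. a \<noteq> b \<longrightarrow> r a b \<longrightarrow> c a \<noteq> (c b :: nat))"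
  using assms(1) deg
proof (induction Y rule: finite_induct)
  case empty
  then show ?case by simp
next
  case (insert y Y)
  have "card {b \<in> Y. r a b} < k" if "a \<in> Y" for a
    using insert.prems[of a] insert.hyps that
      card_mono[of "{b \<in> insert y Y. r a b}" "{b \<in> Y. r a b}"]
    by (fastforce intro: le_less_trans)
  then obtain c where c: "\<forall>a\<in>Y. c a < k" "\<forall>a\<in>Y. \<forall>b\<in>Y. a \<noteq> b \<longrightarrow> r a b \<longrightarrow> c a \<noteq> (c b :: nat)"
    using insert.IH by auto
  have "card (c ` {b \<in> Y. r y b}) \<le> card {b \<in> insert y Y. r y b}"
    using insert.hyps by (intro le_trans[OF card_image_le] card_mono) auto
  then have "card (c ` {b \<in> Y. r y b}) < card {..<k}"
    using insert.prems[of y] by simp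
  then have "\<not> {..<k} \<subseteq> c ` {b \<in> Y. r y b}"
    using insert.hyps card_mono[of "c ` {b \<in> Y. r y b}" "{..<k}"] by auto
  then obtain j where j: "j < k" "j \<notin> c ` {b \<in> Y. r y b}" by auto
  have "y \<noteq> b" if "b \<in> Y" for b using that insert.hyps by auto
  with c j sym show ?case
    by (intro exI[of _ "c(y := j)"]) (auto 0 3)
qed

lemma sum_inverse_squares_le:
  assumes "finite M"
  shows "(\<Sum>m\<in>M. 1 / (real m + 2)\<^sup>2) \<le> 1"
proof -
  obtain N where N: "M \<subseteq> {..<N}" using finite_nat_iff_bounded assms by auto
  \<comment> \<open>The sharper bound \<open>1 - 1 / (N + 1)\<close> lets the induction
    telescope.\<close>
  have "(\<Sum>m<N. 1 / (real m + 2)\<^sup>2) \<le> 1 - 1 / (real N + 1)"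
  proof (induction N)
    case (Suc N)
    have "1 / (real N + 2)\<^sup>2 \<le> 1 / (real N + 1) - 1 / (real N + 2)"
      by (simp add: divide_simps power2_eq_square)
    with Suc show ?case by (simp add: add.commute)
  qed simp
  moreover have "(\<Sum>m\<in>M. 1 / (real m + 2)\<^sup>2) \<le> (\<Sum>m<N. 1 / (real m + 2)\<^sup>2)"
    using N by (intro sum_mono2) auto
  ultimately show ?thesis
    by (smt (verit) divide_nonneg_nonneg of_nat_0_le_iff)
qed

text \<open>A quarter of the rate \<open>c\<close> absorbs the linear factor \<open>d m\<close>;
  logarithmic growth turns the remaining exponential into the power \<open>-(2 + s)\<close> of
  \<open>m + 2\<close>. Two of these powers give a convergent series, the other \<open>s\<close>
  make it small. \<open>C\<close> is fixed before \<open>d\<close>, as the order of quantifiers in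
  the theorem demands.\<close>

lemma log_growth_weights_small:
  fixes c \<theta> :: real
  assumes "0 < c" "0 < \<theta>"
  obtains C :: real where "0 < C"
    and "\<And>d M. (\<And>n. C * ln (real n + 2) \<le> d n) \<Longrightarrow> finite M \<Longrightarrow>
      (\<Sum>m\<in>M. d m * (2 * exp (- (c / 2) * d m))) \<le> \<theta>"
proof -
  \<comment> \<open>\<open>m + 2\<close> is at least 2, so \<open>s\<close> extra powers gain
    \<open>(1 / 2) ^ s\<close>, which has to beat the factor \<open>8 / c\<close> arising
    below.\<close>
  obtain s :: nat where s: "(1 / 2) ^ s < \<theta> * c / 8"
    using real_arch_pow_inv[of "\<theta> * c / 8" "1 / 2"] assms by auto
  \<comment> \<open>Chosen so that \<open>c / 4 * C = 2 + s\<close>.\<close>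
  define C where "C = 4 * (2 + real s) / c"
  have C: "0 < C" using assms by (simp add: C_def)
  moreover have "(\<Sum>m\<in>M. d m * (2 * exp (- (c / 2) * d m))) \<le> \<theta>"
    if d: "\<And>n. C * ln (real n + 2) \<le> d n" and M: "finite M" for d and M :: "nat set"
  proof -
    have "d m * (2 * exp (- (c / 2) * d m)) \<le> \<theta> * (1 / (real m + 2)\<^sup>2)" for m
    proof -
      have "c / 4 * d m \<le> exp (c / 4 * d m)"
        using exp_ge_add_one_self[of "c / 4 * d m"] by linarith
      then have "d m \<le> 4 / c * exp (c / 4 * d m)"
        using assms by (simp add: field_simps)
      then have "d m * (2 * exp (- (c / 2) * d m)) \<le> 4 / c * exp (c / 4 * d m) * (2 * exp (- (c / 2) * d m))"
        by (intro mult_right_mono) auto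
      also have "\<dots> = 8 / c * exp (- (c / 4 * d m))"
        by (simp add: field_simps flip: exp_add)
      also have "\<dots> \<le> 8 / c * (1 / (real m + 2) ^ (2 + s))"
      proof -
        have "c / 4 * (C * ln (real m + 2)) \<le> c / 4 * d m"
          using d[of m] assms by (intro mult_left_mono) auto
        also have "c / 4 * (C * ln (real m + 2)) = real (2 + s) * ln (real m + 2)"
          using assms by (simp add: C_def)
        finally have "exp (- (c / 4 * d m)) \<le> exp (- (real (2 + s) * ln (real m + 2)))" by simp
        also have "\<dots> = 1 / (real m + 2) ^ (2 + s)"
          by (simp only: exp_minus exp_of_nat_mult inverse_eq_divide) simp
        finally show ?thesis using assms by (intro mult_left_mono) auto
      qed
      also have "\<dots> \<le> 8 / c * ((1 / 2) ^ s * (1 / (real m + 2)\<^sup>2))"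
      proof -
        have "2 ^ s * (real m + 2)\<^sup>2 \<le> (real m + 2) ^ (2 + s)"
          unfolding power_add by (subst mult.commute) (intro mult_left_mono power_mono; simp)
        then have "1 / (real m + 2) ^ (2 + s) \<le> 1 / (2 ^ s * (real m + 2)\<^sup>2)"
          by (intro divide_left_mono) auto
        then show ?thesis using assms by (intro mult_left_mono) (auto simp: power_divide)
      qed
      also have "\<dots> = 8 / c * (1 / 2) ^ s * (1 / (real m + 2)\<^sup>2)" by simp
      also have "\<dots> \<le> \<theta> * (1 / (real m + 2)\<^sup>2)"
        using s assms by (intro mult_right_mono) (auto simp: field_simps)
      finally show ?thesis .
    qed
    then have "(\<Sum>m\<in>M. d m * (2 * exp (- (c / 2) * d m))) \<le> (\<Sum>m\<in>M. \<theta> * (1 / (real m + 2)\<^sup>2))"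
      by (intro sum_mono)
    also have "\<dots> = \<theta> * (\<Sum>m\<in>M. 1 / (real m + 2)\<^sup>2)"
      by (simp add: sum_distrib_left)
    also have "\<dots> \<le> \<theta> * 1"
      using assms M by (intro mult_left_mono sum_inverse_squares_le) auto
    finally show ?thesis by simp
  qed
  ultimately show ?thesis by (rule that)
qed

section \<open>The shift action and exponential moments\<close>

locale bernoulli_shift = group \<Gamma> for \<Gamma> (structure)

sublocale bernoulli_shift \<subseteq> S: prob_space "shift_measure \<Gamma>"
  by (rule prob_space_shift_measure)

context bernoulli_shift
begin

lemma shift_act_in_space:
  assumes "x \<in> space (shift_measure \<Gamma>)" "\<gamma> \<in> carrier \<Gamma>"
  shows "shift_act \<Gamma> \<gamma> x \<in> space (shift_measure \<Gamma>)"
  using assms by (auto simp: space_shift_measure shift_act_def PiE_iff)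

lemma shift_act_shift_act:
  assumes "\<gamma> \<in> carrier \<Gamma>" "\<delta> \<in> carrier \<Gamma>"
  shows "shift_act \<Gamma> \<delta> (shift_act \<Gamma> \<gamma> x) = shift_act \<Gamma> (\<delta> \<otimes> \<gamma>) x"
  using assms by (auto simp: shift_act_def m_assoc)

lemma shift_act_one:
  assumes "x \<in> space (shift_measure \<Gamma>)"
  shows "shift_act \<Gamma> \<one> x = x"
  using assms by (auto simp: shift_act_def space_shift_measure PiE_iff extensional_def fun_eq_iff)

lemma measurable_shift_act [measurable]:
  assumes "\<gamma> \<in> carrier \<Gamma>"
  shows "shift_act \<Gamma> \<gamma> \<in> measurable (shift_measure \<Gamma>) (shift_measure \<Gamma>)"
  unfolding shift_measure_def shift_act_def [abs_def]
  using assms by (intro measurable_restrict measurable_component_singleton) auto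

text \<open>Right translation permutes the coordinates, and a product of equal factors is invariant
  under injective reindexing.\<close>

lemma distr_shift_act:
  assumes "\<gamma> \<in> carrier \<Gamma>"
  shows "distr (shift_measure \<Gamma>) (shift_measure \<Gamma>) (shift_act \<Gamma> \<gamma>) = shift_measure \<Gamma>"
  unfolding shift_measure_def shift_act_def [abs_def]
  using assms
  by (intro distr_PiM_reindex prob_space_unit_interval_measure) (auto simp: inj_on_def)

section \<open>Independence of the coordinates and exponential moments of signed sums\<close>

lemma product_prob_space_unit_interval:
  "product_prob_space (\<lambda>_. unit_interval_measure)"
  by (simp add: product_prob_space_def product_prob_space_axioms_def product_sigma_finite_def
      prob_space_unit_interval_measure prob_space_imp_sigma_finite)

lemma measurable_coordinate:
  assumes "i \<in> carrier \<Gamma>"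
  shows "(\<lambda>x. x i) \<in> measurable (shift_measure \<Gamma>) unit_interval_measure"
    and "(\<lambda>x. x i) \<in> borel_measurable (shift_measure \<Gamma>)"
proof -
  show m: "(\<lambda>x. x i) \<in> measurable (shift_measure \<Gamma>) unit_interval_measure"
    unfolding shift_measure_def using assms by (rule measurable_component_singleton)
  have "(\<lambda>u. u) \<in> borel_measurable unit_interval_measure"
    unfolding unit_interval_measure_def by (rule measurable_restrict_space1) simp
  with m show "(\<lambda>x. x i) \<in> borel_measurable (shift_measure \<Gamma>)"
    by (rule measurable_compose)
qed

text \<open>The joint law of all coordinates is the measure itself, hence the product of the
  marginals; restricting to the carrier changes nothing on the space.\<close>

lemma indep_vars_coordinates:
  assumes "I \<subseteq> carrier \<Gamma>"
  shows "S.indep_vars (\<lambda>_. unit_interval_measure) (\<lambda>i x. x i) I"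
proof -
  interpret product_prob_space "\<lambda>_. unit_interval_measure" "carrier \<Gamma>"
    by (rule product_prob_space_unit_interval)
  have "distr (shift_measure \<Gamma>) (Pi\<^sub>M (carrier \<Gamma>) (\<lambda>_. unit_interval_measure))
          (\<lambda>x. \<lambda>i\<in>carrier \<Gamma>. x i) = distr (shift_measure \<Gamma>) (shift_measure \<Gamma>) (\<lambda>x. x)"
    by (rule distr_cong) (auto simp: shift_measure_def space_PiM)
  also have "\<dots> = Pi\<^sub>M (carrier \<Gamma>) (\<lambda>i. distr (shift_measure \<Gamma>) unit_interval_measure (\<lambda>x. x i))"
    using PiM_component by (simp add: distr_id shift_measure_def cong: PiM_cong)
  finally have "S.indep_vars (\<lambda>_. unit_interval_measure) (\<lambda>i x. x i) (carrier \<Gamma>)"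
    using measurable_coordinate(1) by (subst S.indep_vars_iff_distr_eq_PiM') auto
  then show ?thesis
    using assms by (rule S.indep_vars_subset)
qed

text \<open>The translate at \<open>y\<close> reads only the coordinates in \<open>F y\<close>.
  These sets are disjoint, so the expectation of the product of exponentials factorises, and
  Hoeffding's lemma for a centred variable in [-1, 1] bounds each factor by
  \<open>exp (t^2 / 2)\<close>. Arbitrary signs are allowed so that both tails can be treated
  later.\<close>

lemma mgf_independent:
  fixes \<psi> :: "('a \<Rightarrow> real) \<Rightarrow> real"
  assumes F: "finite F" "F \<subseteq> carrier \<Gamma>"
    and m [measurable]: "\<psi> \<in> borel_measurable (PiM F (\<lambda>_. unit_interval_measure))"
    and b: "\<And>z. \<bar>\<psi> z\<bar> \<le> 1"
    and e: "(LINT x|shift_measure \<Gamma>. \<psi> (restrict x F)) = 0"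
    and Y: "finite Y" "Y \<subseteq> carrier \<Gamma>" "disjoint_family_on (\<lambda>y. (\<lambda>i. i \<otimes> y) ` F) Y"
    and s: "\<And>y. \<bar>s y\<bar> = (1::real)" and "t > 0"
  shows "(\<integral>\<^sup>+x. ennreal (exp (t * (\<Sum>y\<in>Y. s y * \<psi> (restrict (shift_act \<Gamma> y x) F)))) \<partial>shift_measure \<Gamma>)
          \<le> ennreal (exp (t\<^sup>2 / 2 * real (card Y)))"
proof -
  define \<phi> where "\<phi> = (\<lambda>x. \<psi> (restrict x F))"
  have mr: "(\<lambda>x. restrict x F) \<in> measurable (shift_measure \<Gamma>) (PiM F (\<lambda>_. unit_interval_measure))"
    unfolding shift_measure_def using F by (rule_tac measurable_restrict_subset) auto
  have [measurable]: "\<phi> \<in> borel_measurable (shift_measure \<Gamma>)"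
    unfolding \<phi>_def using measurable_compose[OF mr m] .
  have "S.indep_vars (\<lambda>y. PiM ((\<lambda>i. i \<otimes> y) ` F) (\<lambda>_. unit_interval_measure))
          (\<lambda>y x. restrict (\<lambda>i. x i) ((\<lambda>i. i \<otimes> y) ` F)) Y"
    using F Y by (intro S.indep_vars_restrict[OF indep_vars_coordinates[OF subset_refl]]) auto
  then have "S.indep_vars (\<lambda>_. borel)
      (\<lambda>y x. ennreal (exp (t * (s y * \<psi> (\<lambda>i\<in>F. restrict (\<lambda>i. x i) ((\<lambda>i. i \<otimes> y) ` F) (i \<otimes> y)))))) Y"
  proof (rule S.indep_vars_compose2[where Y = "\<lambda>y z. ennreal (exp (t * (s y * \<psi> (\<lambda>i\<in>F. z (i \<otimes> y)))))"])
    fix y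
    have [measurable]: "(\<lambda>z. \<lambda>i\<in>F. z (i \<otimes> y)) \<in> measurable
        (PiM ((\<lambda>i. i \<otimes> y) ` F) (\<lambda>_. unit_interval_measure)) (PiM F (\<lambda>_. unit_interval_measure))"
      by (intro measurable_restrict measurable_component_singleton) auto
    show "(\<lambda>z. ennreal (exp (t * (s y * \<psi> (\<lambda>i\<in>F. z (i \<otimes> y)))))) \<in> borel_measurable
        (PiM ((\<lambda>i. i \<otimes> y) ` F) (\<lambda>_. unit_interval_measure))"
      by measurable
  qed
  also have "(\<lambda>y x. ennreal (exp (t * (s y * \<psi> (\<lambda>i\<in>F. restrict (\<lambda>i. x i) ((\<lambda>i. i \<otimes> y) ` F) (i \<otimes> y))))))
      = (\<lambda>y x. ennreal (exp (t * (s y * \<phi> (shift_act \<Gamma> y x)))))"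
    using F by (auto simp: \<phi>_def shift_act_def fun_eq_iff subset_iff
        intro!: arg_cong[where f = \<psi>])
  finally have ind: "S.indep_vars (\<lambda>_. borel) (\<lambda>y x. ennreal (exp (t * (s y * \<phi> (shift_act \<Gamma> y x))))) Y" .
  have "(\<integral>\<^sup>+x. ennreal (exp (t * (\<Sum>y\<in>Y. s y * \<phi> (shift_act \<Gamma> y x)))) \<partial>shift_measure \<Gamma>)
      = (\<integral>\<^sup>+x. (\<Prod>y\<in>Y. ennreal (exp (t * (s y * \<phi> (shift_act \<Gamma> y x))))) \<partial>shift_measure \<Gamma>)"
    using Y by (simp add: sum_distrib_left exp_sum prod_ennreal)
  also have "\<dots> = (\<Prod>y\<in>Y. \<integral>\<^sup>+x. ennreal (exp (t * (s y * \<phi> (shift_act \<Gamma> y x)))) \<partial>shift_measure \<Gamma>)"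
    using S.indep_vars_nn_integral[OF Y(1) ind] Y by (simp add: prod_ennreal)
  also have "\<dots> \<le> (\<Prod>y\<in>Y. ennreal (exp (t\<^sup>2 / 2)))"
  proof (intro prod_mono_ennreal)
    fix y assume "y \<in> Y"
    with Y have y: "y \<in> carrier \<Gamma>" by auto
    interpret I: interval_bounded_random_variable "shift_measure \<Gamma>" "\<lambda>x. s y * \<phi> x" "-1" 1
    proof
      show "AE x in shift_measure \<Gamma>. s y * \<phi> x \<in> {- 1..1}"
      proof (rule AE_I2)
        fix x
        have "\<bar>s y * \<phi> x\<bar> \<le> 1"
          using s[of y] b by (auto simp: abs_mult \<phi>_def)
        then show "s y * \<phi> x \<in> {- 1..1}" by auto
      qed
    qed measurable
    have "(\<integral>\<^sup>+x. ennreal (exp (t * (s y * \<phi> (shift_act \<Gamma> y x)))) \<partial>shift_measure \<Gamma>)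
        = (\<integral>\<^sup>+x. ennreal (exp (t * (s y * \<phi> x)))
            \<partial>distr (shift_measure \<Gamma>) (shift_measure \<Gamma>) (shift_act \<Gamma> y))"
      using y by (subst nn_integral_distr) auto
    also have "\<dots> \<le> ennreal (exp (t\<^sup>2 / 2))"
      unfolding distr_shift_act[OF y]
      using I.Hoeffdings_lemma_nn_integral_0[OF \<open>t > 0\<close>] e by (simp add: \<phi>_def)
    finally show "(\<integral>\<^sup>+x. ennreal (exp (t * (s y * \<phi> (shift_act \<Gamma> y x)))) \<partial>shift_measure \<Gamma>)
      \<le> ennreal (exp (t\<^sup>2 / 2))" .
  qed
  also have "\<dots> = ennreal (exp (t\<^sup>2 / 2 * real (card Y)))"
    by (simp add: ennreal_power flip: exp_of_nat2_mult)
  finally show ?thesis by (simp add: \<phi>_def)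
qed

text \<open>Translates of \<open>\<psi>\<close> based at points of one colour class are independent; Jensen's inequality for
  \<open>exp\<close> reduces the sum over all of \<open>Y\<close> to the colour classes.\<close>

lemma mgf_local:
  fixes \<psi> :: "('a \<Rightarrow> real) \<Rightarrow> real"
  assumes F: "finite F" "F \<subseteq> carrier \<Gamma>"
    and m [measurable]: "\<psi> \<in> borel_measurable (PiM F (\<lambda>_. unit_interval_measure))"
    and b: "\<And>z. \<bar>\<psi> z\<bar> \<le> 1"
    and e: "(LINT x|shift_measure \<Gamma>. \<psi> (restrict x F)) = 0"
    and Y: "finite Y" "Y \<subseteq> carrier \<Gamma>"
    and s: "\<And>y. \<bar>s y\<bar> = (1::real)" and "t > 0"
    and k: "k = (card F)\<^sup>2 + 1"
  shows "(\<integral>\<^sup>+x. ennreal (exp (t * (\<Sum>y\<in>Y. s y * \<psi> (restrict (shift_act \<Gamma> y x) F)))) \<partial>shift_measure \<Gamma>)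
          \<le> ennreal (exp ((real k)\<^sup>2 / 2 * t\<^sup>2 * real (card Y)))"
proof -
  have kpos: "k > 0" using k by simp
  define \<phi> where "\<phi> = (\<lambda>x. \<psi> (restrict x F))"
  define T where "T = (\<lambda>y. (\<lambda>i. i \<otimes> y) ` F)"
  have mr: "(\<lambda>x. restrict x F) \<in> measurable (shift_measure \<Gamma>) (PiM F (\<lambda>_. unit_interval_measure))"
    unfolding shift_measure_def using F by (rule_tac measurable_restrict_subset) auto
  have [measurable]: "\<phi> \<in> borel_measurable (shift_measure \<Gamma>)"
    unfolding \<phi>_def using measurable_compose[OF mr m] .
  \<comment> \<open>If \<open>F y\<close> meets \<open>F y'\<close>, then
    \<open>y' = inv j \<otimes> i \<otimes> y\<close> for some \<open>i\<close> and \<open>j\<close>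
    in \<open>F\<close>, which leaves at most \<open>(card F)^2\<close> choices.\<close>
  have deg: "card {y' \<in> Y. T y \<inter> T y' \<noteq> {}} < k" if "y \<in> Y" for y
  proof -
    have "{y' \<in> Y. T y \<inter> T y' \<noteq> {}} \<subseteq> (\<lambda>(i, j). inv j \<otimes> i \<otimes> y) ` (F \<times> F)"
    proof
      fix y' assume "y' \<in> {y' \<in> Y. T y \<inter> T y' \<noteq> {}}"
      then obtain i j where ij: "i \<in> F" "j \<in> F" "i \<otimes> y = j \<otimes> y'" and "y' \<in> Y"
        unfolding T_def by auto
      then have "y' = inv j \<otimes> (i \<otimes> y)"
        using F Y by (simp add: subset_iff inv_solve_left)
      then show "y' \<in> (\<lambda>(i, j). inv j \<otimes> i \<otimes> y) ` (F \<times> F)"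
        using F Y ij that by (intro image_eqI[of _ _ "(i, j)"]) (auto simp: subset_iff m_assoc)
    qed
    then have "card {y' \<in> Y. T y \<inter> T y' \<noteq> {}} \<le> card (F \<times> F)"
      using F by (intro surj_card_le) auto
    then show ?thesis by (simp add: k card_cartesian_product power2_eq_square)
  qed
  obtain c where c: "\<And>y. y \<in> Y \<Longrightarrow> c y < k"
      "\<And>y y'. y \<in> Y \<Longrightarrow> y' \<in> Y \<Longrightarrow> y \<noteq> y' \<Longrightarrow> T y \<inter> T y' \<noteq> {} \<Longrightarrow> c y \<noteq> (c y' :: nat)"
    using greedy_colouring[of Y "\<lambda>y y'. T y \<inter> T y' \<noteq> {}" k] Y deg by (auto simp: Int_commute) blast
  define Z where "Z = (\<lambda>j. {y \<in> Y. c y = j})"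
  define G where "G = (\<lambda>j x. \<Sum>y\<in>Z j. s y * \<phi> (shift_act \<Gamma> y x))"
  have Zc: "Z j \<subseteq> carrier \<Gamma>" "finite (Z j)" "card (Z j) \<le> card Y" for j
    using Y by (auto simp: Z_def intro: card_mono)
  have G [measurable]: "G j \<in> borel_measurable (shift_measure \<Gamma>)" for j
    unfolding G_def using Zc(1)[of j]
    by (intro borel_measurable_sum borel_measurable_times borel_measurable_const
          measurable_compose[OF measurable_shift_act]) auto
  have Gb: "(\<integral>\<^sup>+x. ennreal (exp (real k * t * G j x)) \<partial>shift_measure \<Gamma>)
      \<le> ennreal (exp ((real k)\<^sup>2 / 2 * t\<^sup>2 * real (card Y)))" for j
  proof -
    have "disjoint_family_on T (Z j)"
      using c by (force simp: disjoint_family_on_def Z_def)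
    then have "(\<integral>\<^sup>+x. ennreal (exp (real k * t * G j x)) \<partial>shift_measure \<Gamma>)
        \<le> ennreal (exp ((real k * t)\<^sup>2 / 2 * real (card (Z j))))"
      unfolding G_def \<phi>_def using Zc \<open>t > 0\<close> kpos
      by (intro mgf_independent F m b e s) (auto simp: T_def)
    also have "\<dots> \<le> ennreal (exp ((real k)\<^sup>2 / 2 * t\<^sup>2 * real (card Y)))"
      using Zc(3)[of j] by (intro ennreal_leI) (auto simp: power_mult_distrib intro!: mult_left_mono)
    finally show ?thesis .
  qed
  have split: "(\<Sum>y\<in>Y. s y * \<phi> (shift_act \<Gamma> y x)) = (\<Sum>j<k. G j x)" for x
    unfolding G_def Z_def using Y c by (intro sum.group[symmetric]) auto
  have "(\<integral>\<^sup>+x. ennreal (exp (t * (\<Sum>y\<in>Y. s y * \<phi> (shift_act \<Gamma> y x)))) \<partial>shift_measure \<Gamma>)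
      \<le> (\<integral>\<^sup>+x. (\<Sum>j<k. ennreal (1 / real k) * ennreal (exp (real k * t * G j x))) \<partial>shift_measure \<Gamma>)"
  proof (intro nn_integral_mono)
    fix x
    \<comment> \<open>Jensen with equal weights \<open>1 / k\<close>: each class sum is multiplied
      by \<open>k\<close>, which is the origin of the factor \<open>k^2\<close> in the
      exponent.\<close>
    have "exp (\<Sum>j<k. (1 / real k) *\<^sub>R (real k * t * G j x)) \<le> (\<Sum>j<k. 1 / real k * exp (real k * t * G j x))"
      using kpos by (intro convex_on_sum[OF _ _ exp_convex]) auto
    also have "(\<Sum>j<k. (1 / real k) *\<^sub>R (real k * t * G j x)) = t * (\<Sum>y\<in>Y. s y * \<phi> (shift_act \<Gamma> y x))"
      using kpos by (simp add: split sum_distrib_left)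
    finally show "ennreal (exp (t * (\<Sum>y\<in>Y. s y * \<phi> (shift_act \<Gamma> y x))))
        \<le> (\<Sum>j<k. ennreal (1 / real k) * ennreal (exp (real k * t * G j x)))"
      by (simp add: ennreal_mult[symmetric] ennreal_leI)
  qed
  also have "\<dots> = (\<Sum>j<k. ennreal (1 / real k) * (\<integral>\<^sup>+x. ennreal (exp (real k * t * G j x)) \<partial>shift_measure \<Gamma>))"
    by (subst nn_integral_sum) (auto intro!: sum.cong nn_integral_cmult)
  also have "\<dots> \<le> (\<Sum>j<k. ennreal (1 / real k) * ennreal (exp ((real k)\<^sup>2 / 2 * t\<^sup>2 * real (card Y))))"
    by (intro sum_mono mult_left_mono Gb) auto
  also have "\<dots> = ennreal (exp ((real k)\<^sup>2 / 2 * t\<^sup>2 * real (card Y)))"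
    using kpos by (simp add: ennreal_mult[symmetric] ennreal_of_nat_eq_real_of_nat)
  finally show ?thesis by (simp add: \<phi>_def)
qed

end

section \<open>Weights of reset histories\<close>

text \<open>The moment rate \<open>t * \<epsilon> - c\<close> is tuned to Markov's inequality at
  level \<open>\<epsilon>\<close>: it costs \<open>t * \<epsilon>\<close> per element, so a net
  decay of rate \<open>c\<close> remains. \<open>c_le\<close> makes the moment bound monotone in
  \<open>card Y\<close>. The last two assumptions are the Local Lemma condition, stated over finite
  \<open>M\<close> to avoid infinite sums.\<close>

locale reset_process = bernoulli_shift \<Gamma> for \<Gamma> :: "('a, 'b) monoid_scheme" (structure) +
  fixes \<phi> :: "('a \<Rightarrow> real) \<Rightarrow> real" and D :: "nat \<Rightarrow> 'a set" and \<epsilon> t c \<theta> :: real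
  assumes \<phi>_measurable [measurable]: "\<phi> \<in> borel_measurable (shift_measure \<Gamma>)"
    and t_pos: "0 < t" and eps_pos: "0 < \<epsilon>" and c_pos: "0 < c" and c_le: "c \<le> t * \<epsilon>"
    and mgf: "\<And>Y s. finite Y \<Longrightarrow> Y \<subseteq> carrier \<Gamma> \<Longrightarrow> (\<And>y. \<bar>s y\<bar> = (1::real)) \<Longrightarrow>
      (\<integral>\<^sup>+x. ennreal (exp (t * (\<Sum>y\<in>Y. s y * \<phi> (shift_act \<Gamma> y x)))) \<partial>shift_measure \<Gamma>)
        \<le> ennreal (exp ((t * \<epsilon> - c) * real (card Y)))"
    and D_finite: "\<And>n. finite (D n)" and D_carrier: "\<And>n. D n \<subseteq> carrier \<Gamma>"
    and \<theta>_le: "\<theta> \<le> c / 2"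
    and \<theta>: "\<And>M. finite M \<Longrightarrow> (\<Sum>m\<in>M. real (card (D m)) * (2 * exp (- (c / 2) * real (card (D m))))) \<le> \<theta>"
begin

text \<open>\<open>p n\<close> is the Chernoff bound for one failure, with 2 for the two tails.
  \<open>q n\<close> is the Local Lemma weight assigned to the label; giving up half of the decay
  rate makes room for the neighbours.\<close>

definition p :: "nat \<Rightarrow> real" where "p n = 2 * exp (- c * real (card (D n)))"
definition q :: "nat \<Rightarrow> real" where "q n = 2 * exp (- (c / 2) * real (card (D n)))"

lemma p_nonneg: "0 \<le> p n" and q_nonneg: "0 \<le> q n"
  by (simp_all add: p_def q_def)

lemma \<theta>_q: "finite M \<Longrightarrow> (\<Sum>m\<in>M. real (card (D m)) * q m) \<le> \<theta>"
  unfolding q_def by (rule \<theta>)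

lemma \<theta>_nonneg: "0 \<le> \<theta>"
  using \<theta>[of "{}"] by simp

text \<open>The factor \<open>exp (\<theta> * card (D n))\<close> will bound the total contribution
  of the neighbours of one label; the gap between the rates \<open>c\<close> and
  \<open>c / 2\<close> absorbs it.\<close>

lemma p_le_q: "p n * exp (\<theta> * real (card (D n))) \<le> q n"
proof -
  have "\<theta> * real (card (D n)) \<le> c / 2 * real (card (D n))"
    using \<theta>_le by (intro mult_right_mono) auto
  then show ?thesis
    by (simp add: p_def q_def flip: exp_add)
qed

definition tile :: "nat \<times> 'a \<Rightarrow> 'a set" where
  "tile v = (\<lambda>\<delta>. \<delta> \<otimes> snd v) ` D (fst v)"

text \<open>Labels \<open>(n, \<gamma>)\<close> stand for the set \<open>D n \<gamma>\<close> of group elements. A list of label sets encodes a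
  history of resets read backwards: the tail of the list happened before its head.\<close>

definition cover :: "(nat \<times> 'a) set list \<Rightarrow> 'a set" where
  "cover l = (\<Union>I\<in>set l. \<Union>v\<in>I. tile v)"

definition field_sum :: "'a set \<Rightarrow> ('a \<Rightarrow> real) \<Rightarrow> real" where
  "field_sum U x = (\<Sum>y\<in>U. \<phi> (shift_act \<Gamma> y x))"

text \<open>Values on \<open>cover l\<close> were reset to 0 by older layers, so only the rest of a
  tile has to produce the large sum. Neither times nor reset sets occur here, so the event is a
  condition on the values of \<open>\<phi>\<close> alone.\<close>

fun legal :: "(nat \<times> 'a) set list \<Rightarrow> ('a \<Rightarrow> real) \<Rightarrow> bool" where
  "legal [] x \<longleftrightarrow> True"
| "legal (I # l) x \<longleftrightarrow> disjoint_family_on tile I \<and>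
     (\<forall>v\<in>I. \<epsilon> * real (card (D (fst v))) < \<bar>field_sum (tile v - cover l) x\<bar>) \<and> legal l x"

fun weight :: "(nat \<times> 'a) set list \<Rightarrow> real" where
  "weight [] = 1"
| "weight (I # l) = (\<Prod>v\<in>I. p (fst v)) * weight l"

abbreviation labels :: "(nat \<times> 'a) set" where "labels \<equiv> UNIV \<times> carrier \<Gamma>"

lemma weight_nonneg: "0 \<le> weight l"
  by (induction l) (auto intro!: mult_nonneg_nonneg prod_nonneg p_nonneg)

lemma finite_tile: "finite (tile v)"
  by (simp add: tile_def D_finite)

lemma card_tile_le: "card (tile v) \<le> card (D (fst v))"
  unfolding tile_def by (rule card_image_le[OF D_finite])

lemma tile_carrier: "v \<in> labels \<Longrightarrow> tile v \<subseteq> carrier \<Gamma>"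
  by (auto simp: tile_def intro!: m_closed dest: subsetD[OF D_carrier])

lemma cover_Nil [simp]: "cover [] = {}"
  and cover_Cons [simp]: "cover (I # l) = (\<Union>v\<in>I. tile v) \<union> cover l"
  by (auto simp: cover_def)

section \<open>The probability of one fixed history\<close>

lemma measurable_signed_sum:
  "Y \<subseteq> carrier \<Gamma> \<Longrightarrow> (\<lambda>x. \<Sum>y\<in>Y. s y * \<phi> (shift_act \<Gamma> y x)) \<in> borel_measurable (shift_measure \<Gamma>)"
  by (intro borel_measurable_sum borel_measurable_times borel_measurable_const
      measurable_compose[OF measurable_shift_act \<phi>_measurable]) auto

lemma measurable_field_sum:
  "Y \<subseteq> carrier \<Gamma> \<Longrightarrow> field_sum Y \<in> borel_measurable (shift_measure \<Gamma>)"
  using measurable_signed_sum[of Y "\<lambda>_. 1"] by (simp add: field_sum_def [abs_def])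

text \<open>The sets \<open>tile v - cover l\<close> belonging to one history are pairwise disjoint. After the Markov
  bound \<open>1 \<le> exp (-t \<epsilon> d) (exp (t S) + exp (-t S))\<close> on \<open>\<epsilon> d < \<bar>S\<bar>\<close>, everything is therefore a single signed
  sum over a disjoint union, to which the moment bound \<open>mgf\<close> applies. The extra set \<open>Y\<close> carries the part of
  the sum that has already been accumulated.\<close>

lemma layer_mgf:
  assumes B [measurable]: "B \<in> sets (shift_measure \<Gamma>)" and "0 \<le> w"
    and hyp: "\<And>Y s. finite Y \<Longrightarrow> Y \<subseteq> carrier \<Gamma> \<Longrightarrow> Y \<inter> C = {} \<Longrightarrow> (\<And>y. \<bar>s y\<bar> = (1::real)) \<Longrightarrow>
      (\<integral>\<^sup>+x. ennreal (exp (t * (\<Sum>y\<in>Y. s y * \<phi> (shift_act \<Gamma> y x)))) * indicator B x \<partial>shift_measure \<Gamma>)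
        \<le> ennreal (exp ((t * \<epsilon> - c) * real (card Y)) * w)"
    and I: "finite I" "I \<subseteq> labels" "disjoint_family_on tile I"
    and Y: "finite Y" "Y \<subseteq> carrier \<Gamma>" "Y \<inter> C = {}" "Y \<inter> (\<Union>v\<in>I. tile v) = {}"
    and s: "\<And>y. \<bar>s y\<bar> = (1::real)"
  shows "(\<integral>\<^sup>+x. ennreal (exp (t * (\<Sum>y\<in>Y. s y * \<phi> (shift_act \<Gamma> y x)))) *
        indicator {x \<in> B. \<forall>v\<in>I. \<epsilon> * real (card (D (fst v))) < \<bar>field_sum (tile v - C) x\<bar>} x
          \<partial>shift_measure \<Gamma>)
      \<le> ennreal (exp ((t * \<epsilon> - c) * real (card Y)) * ((\<Prod>v\<in>I. p (fst v)) * w))"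
  using I Y s
proof (induction I arbitrary: Y s rule: finite_induct)
  case empty
  then show ?case using hyp[of Y s] by simp
next
  case (insert v I)
  define d where "d = real (card (D (fst v)))"
  define U where "U = tile v - C"
  define P where "P = (\<Prod>v\<in>I. p (fst v))"
  define BI where "BI = {x \<in> B. \<forall>v\<in>I. \<epsilon> * real (card (D (fst v))) < \<bar>field_sum (tile v - C) x\<bar>}"
  have "0 \<le> P" by (auto simp: P_def intro!: prod_nonneg p_nonneg)
  have BI [measurable]: "BI \<in> sets (shift_measure \<Gamma>)"
  proof -
    have m: "field_sum (tile v - C) \<in> borel_measurable (shift_measure \<Gamma>)" if "v \<in> I" for v
      using insert.prems that tile_carrier by (intro measurable_field_sum) blast
    have "BI = B \<inter> {x \<in> space (shift_measure \<Gamma>). \<forall>v\<in>I. \<epsilon> * real (card (D (fst v))) < \<bar>field_sum (tile v - C) x\<bar>}"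
      using sets.sets_into_space[OF B] by (auto simp: BI_def)
    also have "\<dots> \<in> sets (shift_measure \<Gamma>)"
      using insert.hyps m by (intro sets.Int B sets.sets_Collect_finite_All borel_measurable_less
         borel_measurable_const borel_measurable_abs) auto
    finally show ?thesis .
  qed
  have U: "finite U" "U \<subseteq> carrier \<Gamma>" "U \<inter> Y = {}" "U \<inter> C = {}"
    using insert.prems tile_carrier[of v] finite_tile by (auto simp: U_def)
  have Ud: "real (card U) \<le> d"
    unfolding d_def U_def using card_tile_le[of v] card_mono[OF finite_tile, of "tile v - C" v] by simp
  have UI: "U \<inter> (\<Union>v\<in>I. tile v) = {}"
    using insert.prems(2) insert.hyps by (force simp: disjoint_family_on_def U_def)
  define ss where "ss = (\<lambda>\<sigma> y. if y \<in> U then \<sigma> else s y :: real)"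
  have sum_ss: "(\<Sum>y\<in>Y \<union> U. ss \<sigma> y * \<phi> (shift_act \<Gamma> y x))
      = (\<Sum>y\<in>Y. s y * \<phi> (shift_act \<Gamma> y x)) + \<sigma> * field_sum U x" for \<sigma> x
  proof -
    have "(\<Sum>y\<in>Y \<union> U. ss \<sigma> y * \<phi> (shift_act \<Gamma> y x))
       = (\<Sum>y\<in>Y. ss \<sigma> y * \<phi> (shift_act \<Gamma> y x)) + (\<Sum>y\<in>U. ss \<sigma> y * \<phi> (shift_act \<Gamma> y x))"
      using U insert.prems by (intro sum.union_disjoint) auto
    also have "(\<Sum>y\<in>Y. ss \<sigma> y * \<phi> (shift_act \<Gamma> y x)) = (\<Sum>y\<in>Y. s y * \<phi> (shift_act \<Gamma> y x))"
      using U by (intro sum.cong) (auto simp: ss_def)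
    also have "(\<Sum>y\<in>U. ss \<sigma> y * \<phi> (shift_act \<Gamma> y x)) = \<sigma> * field_sum U x"
      by (simp add: ss_def field_sum_def sum_distrib_left)
    finally show ?thesis .
  qed
  define X where "X = (\<lambda>\<sigma> x. ennreal (exp (t * (\<Sum>y\<in>Y \<union> U. ss \<sigma> y * \<phi> (shift_act \<Gamma> y x)))) * indicator BI x)"
  have [measurable]: "X \<sigma> \<in> borel_measurable (shift_measure \<Gamma>)" for \<sigma>
  proof -
    have [measurable]: "(\<lambda>x. \<Sum>y\<in>Y \<union> U. ss \<sigma> y * \<phi> (shift_act \<Gamma> y x)) \<in> borel_measurable (shift_measure \<Gamma>)"
      using U insert.prems by (intro measurable_signed_sum) auto
    show ?thesis unfolding X_def by measurable
  qed
  \<comment> \<open>The induction hypothesis is used for \<open>Y \<union> U\<close>: the label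
    \<open>v\<close> has left the list of conditions, and its unreset part has joined the
    exponential sum with sign \<open>\<sigma>\<close>.\<close>
  have X: "(\<integral>\<^sup>+x. X \<sigma> x \<partial>shift_measure \<Gamma>)
      \<le> ennreal (exp ((t * \<epsilon> - c) * real (card Y)) * exp ((t * \<epsilon> - c) * d) * (P * w))"
    if "\<bar>\<sigma>\<bar> = 1" for \<sigma>
  proof -
    have "(\<integral>\<^sup>+x. X \<sigma> x \<partial>shift_measure \<Gamma>) \<le> ennreal (exp ((t * \<epsilon> - c) * real (card (Y \<union> U))) * (P * w))"
      unfolding X_def BI_def P_def using U UI insert.prems that
      by (intro insert.IH) (auto simp: ss_def disjoint_family_on_def)
    also have "\<dots> \<le> ennreal (exp ((t * \<epsilon> - c) * real (card Y)) * exp ((t * \<epsilon> - c) * d) * (P * w))"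
    proof -
      \<comment> \<open>A partly reset tile contributes at most \<open>d\<close> terms, and the
        coefficient is nonnegative, so counting \<open>d\<close> terms only weakens the
        bound.\<close>
      have "(t * \<epsilon> - c) * real (card (Y \<union> U)) \<le> (t * \<epsilon> - c) * (real (card Y) + d)"
        using Ud card_Un_le[of Y U] c_le by (intro mult_left_mono) auto
      then show ?thesis
        using \<open>0 \<le> P\<close> \<open>0 \<le> w\<close>
        by (intro ennreal_leI mult_right_mono) (auto simp: distrib_left simp flip: exp_add)
    qed
    finally show ?thesis .
  qed
  have "(\<integral>\<^sup>+x. ennreal (exp (t * (\<Sum>y\<in>Y. s y * \<phi> (shift_act \<Gamma> y x)))) *
        indicator {x \<in> B. \<forall>v\<in>insert v I. \<epsilon> * real (card (D (fst v))) < \<bar>field_sum (tile v - C) x\<bar>} x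
          \<partial>shift_measure \<Gamma>)
      \<le> (\<integral>\<^sup>+x. ennreal (exp (- (t * \<epsilon> * d))) * (X 1 x + X (-1) x) \<partial>shift_measure \<Gamma>)"
  proof (intro nn_integral_mono)
    fix x
    define a where "a = (\<Sum>y\<in>Y. s y * \<phi> (shift_act \<Gamma> y x))"
    show "ennreal (exp (t * (\<Sum>y\<in>Y. s y * \<phi> (shift_act \<Gamma> y x)))) *
        indicator {x \<in> B. \<forall>v\<in>insert v I. \<epsilon> * real (card (D (fst v))) < \<bar>field_sum (tile v - C) x\<bar>} x
       \<le> ennreal (exp (- (t * \<epsilon> * d))) * (X 1 x + X (-1) x)"
    proof (cases "x \<in> BI \<and> \<epsilon> * d < \<bar>field_sum U x\<bar>")
      case True
      then have "t * (\<epsilon> * d) \<le> t * \<bar>field_sum U x\<bar>"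
        using t_pos by (intro mult_left_mono) auto
      then have "exp (t * a) \<le> exp (- (t * \<epsilon> * d)) * exp (t * (a + \<bar>field_sum U x\<bar>))"
        by (simp add: algebra_simps flip: exp_add)
      also have "\<dots> \<le> exp (- (t * \<epsilon> * d)) * (exp (t * (a + field_sum U x)) + exp (t * (a - field_sum U x)))"
        by (intro mult_left_mono) (auto simp: abs_if)
      finally show ?thesis
        using True by (simp add: X_def sum_ss a_def[symmetric] indicator_def BI_def
            U_def[symmetric] d_def ennreal_leI flip: ennreal_mult' ennreal_plus)
    next
      case False
      then have "x \<notin> {x \<in> B. \<forall>v\<in>insert v I. \<epsilon> * real (card (D (fst v))) < \<bar>field_sum (tile v - C) x\<bar>}"
        by (auto simp: BI_def U_def d_def)
      then show ?thesis by (subst indicator_simps(2)) auto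
    qed
  qed
  also have "\<dots> = ennreal (exp (- (t * \<epsilon> * d))) *
      ((\<integral>\<^sup>+x. X 1 x \<partial>shift_measure \<Gamma>) + (\<integral>\<^sup>+x. X (-1) x \<partial>shift_measure \<Gamma>))"
    by (simp add: nn_integral_cmult nn_integral_add)
  also have "\<dots> \<le> ennreal (exp (- (t * \<epsilon> * d))) *
      (ennreal (exp ((t * \<epsilon> - c) * real (card Y)) * exp ((t * \<epsilon> - c) * d) * (P * w)) +
       ennreal (exp ((t * \<epsilon> - c) * real (card Y)) * exp ((t * \<epsilon> - c) * d) * (P * w)))"
    by (intro mult_left_mono add_mono X) auto
  also have "\<dots> = ennreal (exp (- (t * \<epsilon> * d)) *
      (2 * (exp ((t * \<epsilon> - c) * real (card Y)) * exp ((t * \<epsilon> - c) * d) * (P * w))))"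
    using \<open>0 \<le> P\<close> \<open>0 \<le> w\<close> by (simp flip: ennreal_mult' ennreal_plus)
  also have "exp (- (t * \<epsilon> * d)) *
      (2 * (exp ((t * \<epsilon> - c) * real (card Y)) * exp ((t * \<epsilon> - c) * d) * (P * w)))
     = exp ((t * \<epsilon> - c) * real (card Y)) * (2 * (exp (- (t * \<epsilon> * d)) * exp ((t * \<epsilon> - c) * d)) * P * w)"
    by (simp add: mult_ac)
  \<comment> \<open>Markov's factor meets the moment bound; together with the 2 from the two signs
    this is exactly \<open>p (fst v)\<close>.\<close>
  also have "exp (- (t * \<epsilon> * d)) * exp ((t * \<epsilon> - c) * d) = exp (- c * d)"
    by (simp add: algebra_simps flip: exp_add)
  also have "2 * exp (- c * d) * P = (\<Prod>v\<in>insert v I. p (fst v))"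
    using insert.hyps by (simp add: P_def p_def d_def)
  finally show ?case by (simp add: mult_ac)
qed

lemma sets_legal:
  assumes "\<And>I. I \<in> set l \<Longrightarrow> finite I \<and> I \<subseteq> labels"
  shows "{x \<in> space (shift_measure \<Gamma>). legal l x} \<in> sets (shift_measure \<Gamma>)"
  using assms
proof (induction l)
  case (Cons I l)
  have m: "field_sum (tile v - cover l) \<in> borel_measurable (shift_measure \<Gamma>)" if "v \<in> I" for v
  proof -
    have "v \<in> labels" using Cons.prems[of I] that by auto
    then show ?thesis using tile_carrier[of v] by (intro measurable_field_sum) auto
  qed
  show ?case
    using Cons m by (auto intro!: sets.sets_Collect_conj sets.sets_Collect_finite_All borel_measurable_less
         borel_measurable_const borel_measurable_abs)
qed simp

text \<open>Layers are peeled off one at a time. The free set \<open>Y\<close> is needed because the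
  new tile parts avoid \<open>cover l\<close> and become part of \<open>Y\<close> for the shorter
  history; \<open>Y = {}\<close> gives the probability.\<close>

lemma legal_mgf:
  assumes "\<And>I. I \<in> set l \<Longrightarrow> finite I \<and> I \<subseteq> labels"
    and "finite Y" "Y \<subseteq> carrier \<Gamma>" "Y \<inter> cover l = {}" "\<And>y. \<bar>s y\<bar> = (1::real)"
  shows "(\<integral>\<^sup>+x. ennreal (exp (t * (\<Sum>y\<in>Y. s y * \<phi> (shift_act \<Gamma> y x)))) *
        indicator {x \<in> space (shift_measure \<Gamma>). legal l x} x \<partial>shift_measure \<Gamma>)
      \<le> ennreal (exp ((t * \<epsilon> - c) * real (card Y)) * weight l)"
  using assms
proof (induction l arbitrary: Y s)
  case Nil
  have "(\<integral>\<^sup>+x. ennreal (exp (t * (\<Sum>y\<in>Y. s y * \<phi> (shift_act \<Gamma> y x)))) *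
        indicator {x \<in> space (shift_measure \<Gamma>). legal [] x} x \<partial>shift_measure \<Gamma>)
     = (\<integral>\<^sup>+x. ennreal (exp (t * (\<Sum>y\<in>Y. s y * \<phi> (shift_act \<Gamma> y x)))) \<partial>shift_measure \<Gamma>)"
    by (intro nn_integral_cong) auto
  then show ?case using mgf[of Y s] Nil by simp
next
  case (Cons I l)
  show ?case
  proof (cases "disjoint_family_on tile I")
    case True
    have "{x \<in> space (shift_measure \<Gamma>). legal (I # l) x} = {x \<in> {x \<in> space (shift_measure \<Gamma>). legal l x}.
        \<forall>v\<in>I. \<epsilon> * real (card (D (fst v))) < \<bar>field_sum (tile v - cover l) x\<bar>}"
      using True by auto
    then show ?thesis
      using Cons.prems True unfolding weight.simps
      by (simp only:) (intro layer_mgf[where C = "cover l"] sets_legal weight_nonneg Cons.IH, auto)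
  next
    case False
    then show ?thesis by (simp add: weight_nonneg)
  qed
qed

lemma prob_legal_le:
  assumes "\<And>I. I \<in> set l \<Longrightarrow> finite I \<and> I \<subseteq> labels"
  shows "S.prob {x \<in> space (shift_measure \<Gamma>). legal l x} \<le> weight l"
proof -
  have "emeasure (shift_measure \<Gamma>) {x \<in> space (shift_measure \<Gamma>). legal l x} \<le> ennreal (weight l)"
    using legal_mgf[of l "{}" "\<lambda>_. 1", OF assms] sets_legal[OF assms] by simp
  then show ?thesis
    by (simp add: S.emeasure_eq_measure weight_nonneg)
qed

section \<open>Summation over all possible histories\<close>

definition nbrs :: "nat set \<Rightarrow> (nat \<times> 'a) set \<Rightarrow> (nat \<times> 'a) set" where
  "nbrs M I = {u \<in> M \<times> carrier \<Gamma>. \<exists>v\<in>I. tile u \<inter> tile v \<noteq> {}}"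

text \<open>Lists of exactly \<open>r\<close> layers starting with \<open>I\<close>, each layer
  consisting of neighbours of the one before. Shorter histories are padded by empty layers, and the
  base case forces the history to have died out. Disjointness within a layer is left to
  \<open>legal\<close>, so that the next layer ranges over all subsets of the neighbours.\<close>

fun stable_seqs :: "nat set \<Rightarrow> nat \<Rightarrow> (nat \<times> 'a) set \<Rightarrow> (nat \<times> 'a) set list set" where
  "stable_seqs M 0 I = (if I = {} then {[]} else {})"
| "stable_seqs M (Suc r) I = (\<Union>J\<in>Pow (nbrs M I). (#) I ` stable_seqs M r J)"

text \<open>\<open>b\<close> lies in the tile of \<open>(m, \<gamma>)\<close> exactly if
  \<open>\<gamma> = inv \<delta> \<otimes> b\<close> for some \<open>\<delta>\<close> in
  \<open>D m\<close>. Hence every point lies in at most \<open>card (D m)\<close> tiles of index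
  \<open>m\<close>, which is the degree count in the hypothesis on \<open>\<theta>\<close>.\<close>

lemma tiles_meeting:
  assumes "B \<subseteq> carrier \<Gamma>" "finite B" "finite M"
  shows "finite {u \<in> M \<times> carrier \<Gamma>. tile u \<inter> B \<noteq> {}}"
    and "(\<Sum>u \<in> {u \<in> M \<times> carrier \<Gamma>. tile u \<inter> B \<noteq> {}}. q (fst u)) \<le> real (card B) * \<theta>"
proof -
  let ?A = "SIGMA m:M. B \<times> D m"
  let ?f = "\<lambda>(m, b, \<delta>). (m, inv \<delta> \<otimes> b)"
  have fin: "finite ?A" using assms D_finite by auto
  have sub: "{u \<in> M \<times> carrier \<Gamma>. tile u \<inter> B \<noteq> {}} \<subseteq> ?f ` ?A"
  proof
    fix u assume "u \<in> {u \<in> M \<times> carrier \<Gamma>. tile u \<inter> B \<noteq> {}}"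
    then obtain m \<gamma> where "u = (m, \<gamma>)" "m \<in> M" "\<gamma> \<in> carrier \<Gamma>" "tile (m, \<gamma>) \<inter> B \<noteq> {}"
      by auto
    then obtain \<delta> where u: "u = (m, \<gamma>)" "m \<in> M" "\<gamma> \<in> carrier \<Gamma>" "\<delta> \<in> D m" "\<delta> \<otimes> \<gamma> \<in> B"
      by (auto simp: tile_def)
    moreover have "\<delta> \<in> carrier \<Gamma>" using u D_carrier by auto
    ultimately show "u \<in> ?f ` ?A"
      by (intro image_eqI[of _ _ "(m, \<delta> \<otimes> \<gamma>, \<delta>)"]) (auto simp: inv_solve_left)
  qed
  show "finite {u \<in> M \<times> carrier \<Gamma>. tile u \<inter> B \<noteq> {}}"
    using finite_subset[OF sub] fin by auto
  have "(\<Sum>u \<in> {u \<in> M \<times> carrier \<Gamma>. tile u \<inter> B \<noteq> {}}. q (fst u)) \<le> (\<Sum>u\<in>?f ` ?A. q (fst u))"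
    using fin sub by (intro sum_mono2) (auto intro: q_nonneg)
  also have "\<dots> \<le> (\<Sum>a\<in>?A. q (fst (?f a)))"
    using fin sum_image_le[of ?A "\<lambda>u. q (fst u)" ?f] by (simp add: q_nonneg comp_def)
  also have "\<dots> = (\<Sum>m\<in>M. \<Sum>a\<in>B \<times> D m. q m)"
    using assms D_finite by (subst sum.Sigma) (auto simp: case_prod_beta)
  also have "\<dots> = real (card B) * (\<Sum>m\<in>M. real (card (D m)) * q m)"
    by (simp add: card_cartesian_product sum_distrib_left mult_ac)
  also have "\<dots> \<le> real (card B) * \<theta>"
    using assms by (intro mult_left_mono \<theta>_q) auto
  finally show "(\<Sum>u \<in> {u \<in> M \<times> carrier \<Gamma>. tile u \<inter> B \<noteq> {}}. q (fst u)) \<le> real (card B) * \<theta>" .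
qed

lemma nbrs_props:
  assumes "finite M" "finite I" "I \<subseteq> labels"
  shows "finite (nbrs M I)" "(\<Sum>u\<in>nbrs M I. q (fst u)) \<le> (\<Sum>v\<in>I. real (card (D (fst v))) * \<theta>)"
proof -
  let ?N = "\<lambda>v. {u \<in> M \<times> carrier \<Gamma>. tile u \<inter> tile v \<noteq> {}}"
  have N: "nbrs M I = (\<Union>v\<in>I. ?N v)" by (auto simp: nbrs_def)
  have fin: "finite (?N v)" if "v \<in> I" for v
    using assms that tile_carrier finite_tile by (intro tiles_meeting) auto
  show "finite (nbrs M I)" unfolding N using fin assms by auto
  have "(\<Sum>u\<in>nbrs M I. q (fst u)) \<le> (\<Sum>v\<in>I. \<Sum>u\<in>?N v. q (fst u))"
  proof -
    have "nbrs M I = snd ` (SIGMA v:I. ?N v)" unfolding N by force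
    then have "(\<Sum>u\<in>nbrs M I. q (fst u)) \<le> (\<Sum>a\<in>(SIGMA v:I. ?N v). q (fst (snd a)))"
      using sum_image_le[of "SIGMA v:I. ?N v" "\<lambda>u. q (fst u)" snd] fin assms
      by (simp add: q_nonneg comp_def)
    also have "\<dots> = (\<Sum>v\<in>I. \<Sum>u\<in>?N v. q (fst u))"
      using fin assms by (subst sum.Sigma) (auto simp: case_prod_beta)
    finally show ?thesis .
  qed
  also have "\<dots> \<le> (\<Sum>v\<in>I. real (card (D (fst v))) * \<theta>)"
  proof (intro sum_mono)
    fix v assume "v \<in> I"
    then have "(\<Sum>u\<in>?N v. q (fst u)) \<le> real (card (tile v)) * \<theta>"
      using assms tile_carrier finite_tile by (intro tiles_meeting) auto
    also have "\<dots> \<le> real (card (D (fst v))) * \<theta>"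
      using card_tile_le[of v] \<theta>_nonneg by (intro mult_right_mono) auto
    finally show "(\<Sum>u\<in>?N v. q (fst u)) \<le> real (card (D (fst v))) * \<theta>" .
  qed
  finally show "(\<Sum>u\<in>nbrs M I. q (fst u)) \<le> (\<Sum>v\<in>I. real (card (D (fst v))) * \<theta>)" .
qed

text \<open>The cluster-expansion form of the Local Lemma: the weights \<open>q\<close> satisfy
  \<open>p v (\<Prod>u\<in>nbrs v. 1 + q u) \<le> q v\<close>, which is exactly what the induction on the number of layers needs.\<close>

lemma stable_seqs_props:
  assumes "finite M" "finite I" "I \<subseteq> labels"
  shows "finite (stable_seqs M r I)"
    and "\<And>l J. l \<in> stable_seqs M r I \<Longrightarrow> J \<in> set l \<Longrightarrow> finite J \<and> J \<subseteq> labels"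
    and "(\<Sum>l\<in>stable_seqs M r I. weight l) \<le> (\<Prod>v\<in>I. q (fst v))"
proof -
  have "finite (stable_seqs M r I) \<and> (\<forall>l J. l \<in> stable_seqs M r I \<longrightarrow> J \<in> set l \<longrightarrow> finite J \<and> J \<subseteq> labels)
      \<and> (\<Sum>l\<in>stable_seqs M r I. weight l) \<le> (\<Prod>v\<in>I. q (fst v))"
    using assms
  proof (induction r arbitrary: I)
    case 0
    then show ?case by (auto intro!: prod_nonneg q_nonneg)
  next
    case (Suc r)
    let ?N = "nbrs M I"
    have N: "finite ?N" "?N \<subseteq> labels"
      using nbrs_props[of M I] Suc.prems by (auto simp: nbrs_def)
    have IHf: "finite (stable_seqs M r J)"
      and IHl: "\<And>l J'. l \<in> stable_seqs M r J \<Longrightarrow> J' \<in> set l \<Longrightarrow> finite J' \<and> J' \<subseteq> labels"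
      and IHs: "(\<Sum>l\<in>stable_seqs M r J. weight l) \<le> (\<Prod>v\<in>J. q (fst v))" if "J \<subseteq> ?N" for J
    proof -
      have "finite J" "J \<subseteq> labels" using finite_subset[OF that N(1)] that N(2) by simp_all
      from Suc.IH[OF \<open>finite M\<close> this]
      show "finite (stable_seqs M r J)"
        and "\<And>l J'. l \<in> stable_seqs M r J \<Longrightarrow> J' \<in> set l \<Longrightarrow> finite J' \<and> J' \<subseteq> labels"
        and "(\<Sum>l\<in>stable_seqs M r J. weight l) \<le> (\<Prod>v\<in>J. q (fst v))" by blast+
    qed
    have P0: "0 \<le> (\<Prod>v\<in>I. p (fst v))" by (intro prod_nonneg) (simp add: p_nonneg)
    have exp_bound: "(\<Sum>J\<in>Pow ?N. \<Prod>v\<in>J. q (fst v)) \<le> (\<Prod>v\<in>I. exp (\<theta> * real (card (D (fst v)))))"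
    proof -
      \<comment> \<open>As every subset of the neighbours may be the next layer, the sum factorises
        into \<open>1 + q u\<close>, and then \<open>1 + q \<le> exp q\<close>.\<close>
      have "(\<Sum>J\<in>Pow ?N. \<Prod>v\<in>J. q (fst v)) = (\<Prod>u\<in>?N. q (fst u) + 1)"
        using N(1) by (simp add: prod_add)
      also have "\<dots> \<le> (\<Prod>u\<in>?N. exp (q (fst u)))"
        by (intro prod_mono) (auto simp: q_nonneg add.commute[of _ 1])
      also have "\<dots> = exp (\<Sum>u\<in>?N. q (fst u))"
        using N(1) by (simp add: exp_sum)
      also have "\<dots> \<le> exp (\<Sum>v\<in>I. \<theta> * real (card (D (fst v))))"
        using nbrs_props(2)[OF Suc.prems] by (simp add: mult.commute)
      also have "\<dots> = (\<Prod>v\<in>I. exp (\<theta> * real (card (D (fst v)))))"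
        using Suc.prems(2) by (simp add: exp_sum)
      finally show ?thesis .
    qed
    have "(\<Sum>l\<in>stable_seqs M (Suc r) I. weight l)
       \<le> (\<Sum>J\<in>Pow ?N. \<Sum>l\<in>stable_seqs M r J. weight (I # l))"
    proof -
      let ?A = "SIGMA J:Pow ?N. stable_seqs M r J"
      have fin: "finite ?A" using N(1) IHf by (intro finite_SigmaI) auto
      have "stable_seqs M (Suc r) I = (\<lambda>a. I # snd a) ` ?A" by (auto simp: image_iff)
      then have "(\<Sum>l\<in>stable_seqs M (Suc r) I. weight l) \<le> (\<Sum>a\<in>?A. weight (I # snd a))"
        using sum_image_le[of ?A weight "\<lambda>a. I # snd a", OF fin weight_nonneg]
        by (simp only: comp_def)
      also have "\<dots> = (\<Sum>J\<in>Pow ?N. \<Sum>l\<in>stable_seqs M r J. weight (I # l))"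
        using IHf N(1) by (subst sum.Sigma) (auto simp: case_prod_beta)
      finally show ?thesis .
    qed
    also have "\<dots> = (\<Prod>v\<in>I. p (fst v)) * (\<Sum>J\<in>Pow ?N. \<Sum>l\<in>stable_seqs M r J. weight l)"
      by (simp add: sum_distrib_left)
    also have "\<dots> \<le> (\<Prod>v\<in>I. p (fst v)) * (\<Sum>J\<in>Pow ?N. \<Prod>v\<in>J. q (fst v))"
      by (intro mult_left_mono[OF _ P0] sum_mono IHs) auto
    also have "\<dots> \<le> (\<Prod>v\<in>I. p (fst v)) * (\<Prod>v\<in>I. exp (\<theta> * real (card (D (fst v)))))"
      by (rule mult_left_mono[OF exp_bound P0])
    also have "\<dots> = (\<Prod>v\<in>I. p (fst v) * exp (\<theta> * real (card (D (fst v)))))"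
      by (simp add: prod.distrib)
    also have "\<dots> \<le> (\<Prod>v\<in>I. q (fst v))"
      by (intro prod_mono conjI p_le_q mult_nonneg_nonneg p_nonneg) auto
    finally have "(\<Sum>l\<in>stable_seqs M (Suc r) I. weight l) \<le> (\<Prod>v\<in>I. q (fst v))" .
    moreover have "finite (stable_seqs M (Suc r) I)"
      using IHf N(1) by simp
    moreover have "finite J' \<and> J' \<subseteq> labels" if l: "l \<in> stable_seqs M (Suc r) I" "J' \<in> set l" for l J'
    proof -
      obtain J l' where "J \<subseteq> ?N" "l = I # l'" "l' \<in> stable_seqs M r J"
        using l(1) unfolding stable_seqs.simps by blast
      with IHl[of J l' J'] l(2) Suc.prems show ?thesis by auto
    qed
    ultimately show ?case by blast
  qed
  then show "finite (stable_seqs M r I)"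
    and "\<And>l J. l \<in> stable_seqs M r I \<Longrightarrow> J \<in> set l \<Longrightarrow> finite J \<and> J \<subseteq> labels"
    and "(\<Sum>l\<in>stable_seqs M r I. weight l) \<le> (\<Prod>v\<in>I. q (fst v))" by blast+
qed

text \<open>A union bound over the top label and its histories. Histories with top label
  \<open>v\<close> have total weight at most \<open>q (fst v)\<close>, and summing over the tiles
  through the single point \<open>\<one>\<close> gives \<open>\<theta>\<close>, uniformly in
  \<open>M\<close> and \<open>r\<close>.\<close>

lemma prob_stable_le:
  assumes "finite M"
  shows "S.prob (\<Union>v\<in>{v \<in> M \<times> carrier \<Gamma>. tile v \<inter> {\<one>} \<noteq> {}}. \<Union>l\<in>stable_seqs M r {v}.
            {x \<in> space (shift_measure \<Gamma>). legal l x}) \<le> \<theta>"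
    and "(\<Union>v\<in>{v \<in> M \<times> carrier \<Gamma>. tile v \<inter> {\<one>} \<noteq> {}}. \<Union>l\<in>stable_seqs M r {v}.
            {x \<in> space (shift_measure \<Gamma>). legal l x}) \<in> sets (shift_measure \<Gamma>)"
proof -
  let ?V = "{v \<in> M \<times> carrier \<Gamma>. tile v \<inter> {\<one>} \<noteq> {}}"
  let ?E = "\<lambda>l. {x \<in> space (shift_measure \<Gamma>). legal l x}"
  have V: "finite ?V" "(\<Sum>v\<in>?V. q (fst v)) \<le> \<theta>"
    using tiles_meeting[of "{\<one>}" M] assms by auto
  have lab: "finite {v}" "{v} \<subseteq> labels" if "v \<in> ?V" for v using that by auto
  note st = stable_seqs_props[OF assms lab]
  have E: "?E l \<in> sets (shift_measure \<Gamma>)" "S.prob (?E l) \<le> weight l" if "v \<in> ?V" "l \<in> stable_seqs M r {v}" for v l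
    using st(2)[OF that(1) that(1,2)] by (auto intro!: sets_legal prob_legal_le)
  have Em: "(\<Union>l\<in>stable_seqs M r {v}. ?E l) \<in> sets (shift_measure \<Gamma>)" if "v \<in> ?V" for v
    by (rule sets.finite_UN[OF st(1)[OF that that] E(1)[OF that]])
  show "(\<Union>v\<in>?V. \<Union>l\<in>stable_seqs M r {v}. ?E l) \<in> sets (shift_measure \<Gamma>)"
    by (rule sets.finite_UN[OF V(1) Em])
  have "S.prob (\<Union>v\<in>?V. \<Union>l\<in>stable_seqs M r {v}. ?E l) \<le> (\<Sum>v\<in>?V. S.prob (\<Union>l\<in>stable_seqs M r {v}. ?E l))"
    using Em by (intro S.finite_measure_subadditive_finite V(1)) blast
  also have "\<dots> \<le> (\<Sum>v\<in>?V. \<Sum>l\<in>stable_seqs M r {v}. S.prob (?E l))"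
  proof (intro sum_mono S.finite_measure_subadditive_finite)
    fix v assume "v \<in> ?V"
    then show "finite (stable_seqs M r {v})" "?E ` stable_seqs M r {v} \<subseteq> S.events"
      using st(1) E(1) by blast+
  qed
  also have "\<dots> \<le> (\<Sum>v\<in>?V. \<Sum>l\<in>stable_seqs M r {v}. weight l)"
    using E by (intro sum_mono) auto
  also have "\<dots> \<le> (\<Sum>v\<in>?V. q (fst v))"
    using st(3) by (intro sum_mono) fastforce
  also have "\<dots> \<le> \<theta>" by fact
  finally show "S.prob (\<Union>v\<in>?V. \<Union>l\<in>stable_seqs M r {v}. ?E l) \<le> \<theta>" .
qed

end

section \<open>The reset process\<close>

context bernoulli_shift
begin

text \<open>The diagonal of the unit square is covered by \<open>k\<close> squares of side
  \<open>1 / k\<close>, of total area \<open>1 / k\<close>, for every \<open>k\<close>.\<close>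

lemma AE_coordinates_distinct:
  assumes "\<gamma> \<in> carrier \<Gamma>" "\<gamma> \<noteq> \<one>"
  shows "AE x in shift_measure \<Gamma>. x \<gamma> \<noteq> x \<one>"
proof -
  interpret P: product_prob_space "\<lambda>_. unit_interval_measure" "carrier \<Gamma>"
    by (rule product_prob_space_unit_interval)
  note coord = measurable_coordinate(2)
  define E where "E = {x \<in> space (shift_measure \<Gamma>). x \<gamma> = x \<one>}"
  have Em [measurable]: "E \<in> sets (shift_measure \<Gamma>)"
    unfolding E_def using coord[OF assms(1)] coord[OF one_closed] by measurable
  have "S.prob E \<le> 1 / real (Suc j)" for j
  proof -
    let ?k = "Suc j"
    define J where "J = (\<lambda>a. {real a / real ?k .. real (Suc a) / real ?k} \<inter> {0..1})"
    define X where "X = (\<lambda>a. {x \<in> space (shift_measure \<Gamma>). \<forall>i\<in>{\<one>, \<gamma>}. x i \<in> J a})"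
    have Js: "J a \<in> sets unit_interval_measure" for a
      unfolding J_def unit_interval_measure_def sets_restrict_space
      by (subst Int_commute) (rule imageI, simp)
    have Je: "emeasure unit_interval_measure (J a) \<le> ennreal (1 / real ?k)" for a
    proof -
      have "emeasure unit_interval_measure (J a) = emeasure lborel (J a)"
        unfolding unit_interval_measure_def by (subst emeasure_restrict_space) (auto simp: J_def)
      also have "\<dots> \<le> emeasure lborel {real a / real ?k .. real (Suc a) / real ?k}"
        by (intro emeasure_mono) (auto simp: J_def)
      also have "\<dots> = ennreal (1 / real ?k)"
        by (subst emeasure_lborel_Icc) (auto simp: divide_simps)
      finally show ?thesis .
    qed
    have Xe: "S.prob (X a) \<le> 1 / real ?k * (1 / real ?k)" for a
    proof -
      have "emeasure (shift_measure \<Gamma>) (X a) = (\<Prod>i\<in>{\<one>, \<gamma>}. emeasure unit_interval_measure (J a))"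
        unfolding X_def shift_measure_def using assms Js by (intro P.emeasure_PiM_Collect) auto
      also have "\<dots> = emeasure unit_interval_measure (J a) * emeasure unit_interval_measure (J a)"
        using assms by simp
      also have "\<dots> \<le> ennreal (1 / real ?k) * ennreal (1 / real ?k)"
        by (intro mult_mono Je) auto
      also have "\<dots> = ennreal (1 / real ?k * (1 / real ?k))"
        by (rule ennreal_mult[symmetric]) auto
      finally show ?thesis by (simp add: S.emeasure_eq_measure del: of_nat_Suc)
    qed
    have Xs: "X a \<in> sets (shift_measure \<Gamma>)" for a
      unfolding X_def shift_measure_def using assms Js
      by (intro sets.sets_Collect_finite_All sets_Collect_single') (auto simp: Int_def[symmetric] Collect_conj_eq)
    have "E \<subseteq> (\<Union>a<?k. X a)"
    proof
      fix x assume "x \<in> E"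
      then have x: "x \<in> space (shift_measure \<Gamma>)" "x \<gamma> = x \<one>" by (auto simp: E_def)
      then have u: "0 \<le> x \<one>" "x \<one> \<le> 1" by (auto simp: space_shift_measure PiE_iff)
      \<comment> \<open>The minimum with \<open>j\<close> matters only at
        \<open>x \<one> = 1\<close>, where the floor is \<open>j + 1\<close> and lies beyond the
        last interval.\<close>
      define a where "a = min j (nat \<lfloor>real ?k * x \<one>\<rfloor>)"
      have "real a / real ?k \<le> x \<one> \<and> x \<one> \<le> real (Suc a) / real ?k"
      proof (cases "x \<one> = 1")
        case True
        then have "a = j" by (simp add: a_def)
        then show ?thesis using True by (simp add: divide_simps)
      next
        case False
        with u have "real ?k * x \<one> < real ?k" "0 \<le> real ?k * x \<one>" by (auto simp del: of_nat_Suc)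
        then have "nat \<lfloor>real ?k * x \<one>\<rfloor> < ?k"
          by (simp add: nat_less_iff floor_less_iff del: of_nat_Suc)
        then have a: "a = nat \<lfloor>real ?k * x \<one>\<rfloor>" by (simp add: a_def)
        have "real a = real_of_int \<lfloor>real ?k * x \<one>\<rfloor>"
          unfolding a using \<open>0 \<le> real ?k * x \<one>\<close> by simp
        then have "real a \<le> real ?k * x \<one>" "real ?k * x \<one> \<le> real a + 1"
          by linarith+
        then show ?thesis by (simp add: divide_simps mult.commute)
      qed
      then have "x \<in> X a" using x u by (auto simp: X_def J_def)
      moreover have "a < ?k" by (simp add: a_def)
      ultimately show "x \<in> (\<Union>a<?k. X a)" by blast
    qed
    then have "S.prob E \<le> S.prob (\<Union>a<?k. X a)"
      using Xs by (intro S.finite_measure_mono sets.finite_UN) auto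
    also have "\<dots> \<le> (\<Sum>a<?k. S.prob (X a))"
      using Xs by (intro S.finite_measure_subadditive_finite) auto
    also have "\<dots> \<le> (\<Sum>a<?k. 1 / real ?k * (1 / real ?k))"
      by (intro sum_mono Xe)
    also have "\<dots> = 1 / real ?k" by simp
    finally show ?thesis .
  qed
  then have "S.prob E \<le> 0"
    by (intro LIMSEQ_le_const[OF LIMSEQ_inverse_real_of_nat]) (auto simp: inverse_eq_divide)
  then have "E \<in> null_sets (shift_measure \<Gamma>)"
    using Em by (intro null_setsI) (auto simp: S.emeasure_eq_measure measure_le_0_iff)
  then show ?thesis
    by (rule AE_I') (auto simp: E_def)
qed

end

text \<open>Resetting all bad tiles at once would break the disjointness of the sets in a history. At step \<open>k\<close>
  only tiles of \<open>D (idx k)\<close> based at points of \<open>A k\<close> are treated, and those are pairwise disjoint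
  along every orbit.\<close>

locale scheduled_reset_process = reset_process +
  fixes idx :: "nat \<Rightarrow> nat" and A :: "nat \<Rightarrow> ('a \<Rightarrow> real) set"
  assumes A_sets: "\<And>k. A k \<in> sets (shift_measure \<Gamma>)"
    and A_separated: "\<And>k x \<gamma>. x \<in> A k \<Longrightarrow> \<gamma> \<in> carrier \<Gamma> \<Longrightarrow> shift_act \<Gamma> \<gamma> x \<in> A k \<Longrightarrow>
      tile (idx k, \<gamma>) \<inter> tile (idx k, \<one>) \<noteq> {} \<Longrightarrow> \<gamma> = \<one>"
    and A_recurrent: "AE x in shift_measure \<Gamma>. \<forall>n k. \<exists>j\<ge>k. idx j = n \<and> x \<in> A j"
begin

section \<open>Scheduled resets and their measurability\<close>

definition bad :: "nat \<Rightarrow> ('a \<Rightarrow> real) set \<Rightarrow> ('a \<Rightarrow> real) set" where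
  "bad k R = {x \<in> A k. \<epsilon> * real (card (D (idx k))) <
     \<bar>\<Sum>\<delta>\<in>D (idx k). if shift_act \<Gamma> \<delta> x \<in> R then 0 else \<phi> (shift_act \<Gamma> \<delta> x)\<bar>}"

text \<open>Step \<open>k\<close> adds all points \<open>\<delta> \<cdot> x\<close> with
  \<open>x\<close> bad. They are described through \<open>inv \<delta>\<close>, as preimages instead
  of images, so that measurability is immediate.\<close>

fun reset :: "nat \<Rightarrow> ('a \<Rightarrow> real) set" where
  "reset 0 = {}"
| "reset (Suc k) = reset k \<union> {y \<in> space (shift_measure \<Gamma>).
     \<exists>\<delta>\<in>D (idx k). shift_act \<Gamma> (inv \<delta>) y \<in> bad k (reset k)}"

lemma sets_bad:
  assumes [measurable]: "R \<in> sets (shift_measure \<Gamma>)"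
  shows "bad k R \<in> sets (shift_measure \<Gamma>)"
proof -
  have [measurable]: "(\<lambda>x. if x \<in> R then 0 else \<phi> x) \<in> borel_measurable (shift_measure \<Gamma>)"
    by measurable
  have [measurable]: "(\<lambda>x. \<Sum>\<delta>\<in>D (idx k). if shift_act \<Gamma> \<delta> x \<in> R then 0 else \<phi> (shift_act \<Gamma> \<delta> x))
     \<in> borel_measurable (shift_measure \<Gamma>)"
    using D_carrier
    by (intro borel_measurable_sum measurable_compose[OF measurable_shift_act
          \<open>(\<lambda>x. if x \<in> R then 0 else \<phi> x) \<in> borel_measurable (shift_measure \<Gamma>)\<close>]) auto
  have "bad k R = A k \<inter> {x \<in> space (shift_measure \<Gamma>). \<epsilon> * real (card (D (idx k))) <
     \<bar>\<Sum>\<delta>\<in>D (idx k). if shift_act \<Gamma> \<delta> x \<in> R then 0 else \<phi> (shift_act \<Gamma> \<delta> x)\<bar>}"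
    using sets.sets_into_space[OF A_sets] by (auto simp: bad_def)
  also have "\<dots> \<in> sets (shift_measure \<Gamma>)"
    by (intro sets.Int A_sets) measurable
  finally show ?thesis .
qed

lemma sets_reset: "reset k \<in> sets (shift_measure \<Gamma>)"
proof (induction k)
  case (Suc k)
  have "{y \<in> space (shift_measure \<Gamma>). \<exists>\<delta>\<in>D (idx k). shift_act \<Gamma> (inv \<delta>) y \<in> bad k (reset k)}
     = (\<Union>\<delta>\<in>D (idx k). shift_act \<Gamma> (inv \<delta>) -` bad k (reset k) \<inter> space (shift_measure \<Gamma>))"
    by auto
  also have "\<dots> \<in> sets (shift_measure \<Gamma>)"
    using D_finite D_carrier
    by (intro sets.finite_UN measurable_sets[OF measurable_shift_act] sets_bad Suc.IH inv_closed) auto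
  finally show ?case using Suc.IH by simp
qed simp

text \<open>In the orbit of a fixed point \<open>x\<close>, the event \<open>(k, \<gamma>)\<close> says that \<open>\<gamma> \<cdot> x\<close> is reset at step \<open>k\<close>. Forgetting
  times, \<open>lab\<close> turns events into labels; peeling off successive layers of \<open>maxima\<close> from the causal past
  of an event produces a legal history that does not mention times.\<close>

context
  fixes x assumes x: "x \<in> space (shift_measure \<Gamma>)"
begin

definition event :: "nat \<times> 'a \<Rightarrow> bool" where
  "event e \<longleftrightarrow> snd e \<in> carrier \<Gamma> \<and> shift_act \<Gamma> (snd e) x \<in> bad (fst e) (reset (fst e))"

definition lab :: "nat \<times> 'a \<Rightarrow> nat \<times> 'a" where
  "lab e = (idx (fst e), snd e)"

text \<open>Maximal for the dependence order (earlier, with intersecting tiles), not latest in time: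
  one layer may contain events of different steps.\<close>

definition maxima :: "(nat \<times> 'a) set \<Rightarrow> (nat \<times> 'a) set" where
  "maxima Z = {e \<in> Z. \<forall>e'\<in>Z. fst e < fst e' \<longrightarrow> tile (lab e) \<inter> tile (lab e') = {}}"

definition past_closed :: "(nat \<times> 'a) set \<Rightarrow> bool" where
  "past_closed Z \<longleftrightarrow> (\<forall>e\<in>Z. event e) \<and>
     (\<forall>e\<in>Z. \<forall>e'. event e' \<longrightarrow> fst e' < fst e \<longrightarrow> tile (lab e') \<inter> tile (lab e) \<noteq> {} \<longrightarrow> e' \<in> Z)"

lemma event_lab: "event e \<Longrightarrow> lab e \<in> labels"
  by (auto simp: event_def lab_def)

text \<open>Moves the bookkeeping from points of the space to group elements: along the orbit of
  \<open>x\<close>, the reset set is the union of the tiles of the earlier events.\<close>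

lemma mem_reset_iff:
  assumes "\<eta> \<in> carrier \<Gamma>"
  shows "shift_act \<Gamma> \<eta> x \<in> reset k \<longleftrightarrow> (\<exists>e. event e \<and> fst e < k \<and> \<eta> \<in> tile (lab e))"
proof (induction k)
  case (Suc k)
  have "(\<exists>\<delta>\<in>D (idx k). shift_act \<Gamma> (inv \<delta>) (shift_act \<Gamma> \<eta> x) \<in> bad k (reset k))
      \<longleftrightarrow> (\<exists>e. event e \<and> fst e = k \<and> \<eta> \<in> tile (lab e))" (is "?L \<longleftrightarrow> ?R")
  proof
    assume ?L
    then obtain \<delta> where d: "\<delta> \<in> D (idx k)" "shift_act \<Gamma> (inv \<delta>) (shift_act \<Gamma> \<eta> x) \<in> bad k (reset k)"
      by auto
    then have dc: "\<delta> \<in> carrier \<Gamma>" using D_carrier by auto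
    have "event (k, inv \<delta> \<otimes> \<eta>)"
      using d dc assms by (simp add: event_def shift_act_shift_act)
    moreover have "\<eta> = \<delta> \<otimes> (inv \<delta> \<otimes> \<eta>)"
      using dc assms by (simp flip: m_assoc)
    then have "\<eta> \<in> tile (lab (k, inv \<delta> \<otimes> \<eta>))"
      using d by (auto simp: tile_def lab_def)
    ultimately show ?R by force
  next
    assume ?R
    then obtain \<gamma> \<delta> where g: "event (k, \<gamma>)" "\<delta> \<in> D (idx k)" "\<eta> = \<delta> \<otimes> \<gamma>"
      by (auto simp: tile_def lab_def)
    then have "\<delta> \<in> carrier \<Gamma>" "\<gamma> \<in> carrier \<Gamma>" using D_carrier by (auto simp: event_def)
    then have "shift_act \<Gamma> (inv \<delta>) (shift_act \<Gamma> \<eta> x) = shift_act \<Gamma> \<gamma> x"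
      using g assms by (simp add: shift_act_shift_act inv_solve_left m_assoc[symmetric])
    then show ?L using g by (intro bexI[of _ \<delta>]) (simp_all add: event_def)
  qed
  then show ?case
    using Suc.IH shift_act_in_space[OF x assms] by (auto simp: less_Suc_eq)
qed simp

text \<open>Translating by \<open>inv \<gamma>\<close> moves one event to the base point
  \<open>\<gamma> \<cdot> x\<close>; \<open>A_separated\<close> then identifies the two.\<close>

lemma event_unique:
  assumes "event e" "event e'" "fst e = fst e'" "tile (lab e) \<inter> tile (lab e') \<noteq> {}"
  shows "e = e'"
proof -
  obtain k \<gamma> \<gamma>' where e: "e = (k, \<gamma>)" "e' = (k, \<gamma>')" using assms(3) by (cases e; cases e') auto
  with assms have c: "\<gamma> \<in> carrier \<Gamma>" "\<gamma>' \<in> carrier \<Gamma>" by (auto simp: event_def)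
  from assms(4) e obtain \<delta> \<delta>' where d: "\<delta> \<in> D (idx k)" "\<delta>' \<in> D (idx k)" "\<delta> \<otimes> \<gamma> = \<delta>' \<otimes> \<gamma>'"
    by (auto simp: tile_def lab_def)
  then have dc: "\<delta> \<in> carrier \<Gamma>" "\<delta>' \<in> carrier \<Gamma>" using D_carrier by auto
  have "\<delta>' \<otimes> (\<gamma>' \<otimes> inv \<gamma>) = \<delta> \<otimes> \<gamma> \<otimes> inv \<gamma>"
    using c dc d by (simp add: m_assoc)
  also have "\<dots> = \<delta> \<otimes> \<one>" using c dc by (simp add: m_assoc)
  finally have "tile (idx k, \<gamma>' \<otimes> inv \<gamma>) \<inter> tile (idx k, \<one>) \<noteq> {}"
    using d by (auto simp: tile_def)
  moreover have "shift_act \<Gamma> (\<gamma>' \<otimes> inv \<gamma>) (shift_act \<Gamma> \<gamma> x) = shift_act \<Gamma> \<gamma>' x"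
    using c by (simp add: shift_act_shift_act m_assoc)
  ultimately have "\<gamma>' \<otimes> inv \<gamma> = \<one>"
    using assms e c by (intro A_separated[of "shift_act \<Gamma> \<gamma> x" k]) (auto simp: event_def bad_def)
  then show ?thesis using c e by (metis inv_equality inv_inv inv_closed)
qed

lemma event_field_sum:
  assumes "event e"
  shows "\<epsilon> * real (card (D (fst (lab e)))) <
    \<bar>field_sum (tile (lab e) - {\<eta>. shift_act \<Gamma> \<eta> x \<in> reset (fst e)}) x\<bar>"
proof -
  obtain k \<gamma> where e: "e = (k, \<gamma>)" by (cases e)
  with assms have c: "\<gamma> \<in> carrier \<Gamma>" by (auto simp: event_def)
  have inj: "inj_on (\<lambda>\<delta>. \<delta> \<otimes> \<gamma>) (D (idx k))"
    using c D_carrier[of "idx k"] by (auto simp: inj_on_def subset_iff)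
  have "(\<Sum>\<delta>\<in>D (idx k). if shift_act \<Gamma> \<delta> (shift_act \<Gamma> \<gamma> x) \<in> reset k then 0
            else \<phi> (shift_act \<Gamma> \<delta> (shift_act \<Gamma> \<gamma> x)))
      = (\<Sum>\<delta>\<in>D (idx k). if shift_act \<Gamma> (\<delta> \<otimes> \<gamma>) x \<in> reset k then 0 else \<phi> (shift_act \<Gamma> (\<delta> \<otimes> \<gamma>) x))"
    using c D_carrier[of "idx k"] by (intro sum.cong) (auto simp: shift_act_shift_act subset_iff)
  also have "\<dots> = (\<Sum>\<eta>\<in>tile (lab e). if shift_act \<Gamma> \<eta> x \<in> reset k then 0 else \<phi> (shift_act \<Gamma> \<eta> x))"
    using inj by (simp add: tile_def lab_def e sum.reindex comp_def)
  also have "\<dots> = field_sum (tile (lab e) - {\<eta>. shift_act \<Gamma> \<eta> x \<in> reset k}) x"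
    unfolding field_sum_def using finite_tile
    by (intro sum.mono_neutral_cong_right) auto
  finally show ?thesis
    using assms by (auto simp: e event_def bad_def lab_def)
qed

text \<open>The maximal events form the top layer; what remains is again past closed, and recursion
  yields the older layers. Simultaneous events have disjoint tiles by \<open>event_unique\<close>,
  and events of different times in one layer are disjoint by maximality.\<close>

lemma stable_seq_exists:
  assumes "past_closed Z" "\<And>e. e \<in> Z \<Longrightarrow> fst e < t0" "idx ` {..<t0} \<subseteq> M"
  shows "\<exists>l\<in>stable_seqs M t0 (lab ` maxima Z). legal l x \<and> cover l = (\<Union>e\<in>Z. tile (lab e))"
  using assms
proof (induction t0 arbitrary: Z)
  case 0
  then show ?case by (auto simp: maxima_def)
next
  case (Suc t0)
  define Z' where "Z' = Z - maxima Z"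
  have ev: "event e" if "e \<in> Z" for e
    using Suc.prems that by (auto simp: past_closed_def)
  have past: "e' \<in> Z" if "e \<in> Z" "event e'" "fst e' < fst e" "tile (lab e') \<inter> tile (lab e) \<noteq> {}" for e e'
    using Suc.prems(1) that unfolding past_closed_def by blast
  have maxD: "tile (lab e) \<inter> tile (lab e') = {}" if "e \<in> maxima Z" "e' \<in> Z" "fst e < fst e'" for e e'
    using that by (auto simp: maxima_def)
  have pc: "past_closed Z'"
    unfolding past_closed_def
  proof (intro conjI ballI allI impI)
    fix e e' assume e: "e \<in> Z'" "event e'" "fst e' < fst e" "tile (lab e') \<inter> tile (lab e) \<noteq> {}"
    then have "e \<in> Z" by (simp add: Z'_def)
    with e past maxD show "e' \<in> Z'" unfolding Z'_def by blast
  qed (use ev in \<open>auto simp: Z'_def\<close>)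
  \<comment> \<open>A removed-from-top event is earlier than another event of \<open>Z\<close>, so
    the time bound drops by one and \<open>t0\<close> layers always suffice.\<close>
  have lt: "fst e < t0" if e: "e \<in> Z'" for e
  proof -
    obtain e' where e': "e' \<in> Z" "fst e < fst e'" using e unfolding Z'_def maxima_def by blast
    from Suc.prems(2)[OF e'(1)] e'(2) show ?thesis by simp
  qed
  have "idx ` {..<t0} \<subseteq> M" using Suc.prems(3) by (auto simp: lessThan_Suc)
  from Suc.IH[OF pc lt this] obtain l where l: "l \<in> stable_seqs M t0 (lab ` maxima Z')" "legal l x"
    "cover l = (\<Union>e\<in>Z'. tile (lab e))" by auto
  have "lab ` maxima Z' \<subseteq> nbrs M (lab ` maxima Z)"
  proof
    fix v assume "v \<in> lab ` maxima Z'"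
    then obtain k \<gamma> where v: "v = lab (k, \<gamma>)" and e: "(k, \<gamma>) \<in> maxima Z'" by auto
    then have eZ': "(k, \<gamma>) \<in> Z'" by (simp add: maxima_def)
    then have eZ: "(k, \<gamma>) \<in> Z" "(k, \<gamma>) \<notin> maxima Z" "k < t0"
      using lt[OF eZ'] by (simp_all add: Z'_def)
    then obtain e' where e': "e' \<in> Z" "k < fst e'" "tile (lab (k, \<gamma>)) \<inter> tile (lab e') \<noteq> {}"
      by (auto simp: maxima_def)
    \<comment> \<open>A blocker of \<open>e\<close> that survived in \<open>Z'\<close> would
      contradict the maximality of \<open>e\<close> there, so the blocker lies in the layer directly
      above.\<close>
    have "e' \<in> maxima Z"
    proof (rule ccontr)
      assume "e' \<notin> maxima Z"
      with e' have "e' \<in> Z'" by (simp add: Z'_def)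
      with e e' show False unfolding maxima_def[of Z'] by auto
    qed
    with e' eZ ev[OF eZ(1)] Suc.prems(3) show "v \<in> nbrs M (lab ` maxima Z)"
      by (auto simp: v nbrs_def lab_def event_def)
  qed
  then have st: "lab ` maxima Z # l \<in> stable_seqs M (Suc t0) (lab ` maxima Z)"
    using l(1) by auto
  have dj: "disjoint_family_on tile (lab ` maxima Z)"
    unfolding disjoint_family_on_def
  proof (intro ballI impI)
    fix v v' assume "v \<in> lab ` maxima Z" "v' \<in> lab ` maxima Z" "v \<noteq> v'"
    then obtain e e' where e: "e \<in> maxima Z" "e' \<in> maxima Z" "v = lab e" "v' = lab e'" "e \<noteq> e'" by auto
    then have "e \<in> Z" "e' \<in> Z" by (auto simp: maxima_def)
    with e show "tile v \<inter> tile v' = {}"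
      using maxD[of e e'] maxD[of e' e] event_unique[of e e'] ev
      by (cases "fst e" "fst e'" rule: linorder_cases) (auto simp: Int_commute)
  qed
  have "\<epsilon> * real (card (D (fst (lab e)))) < \<bar>field_sum (tile (lab e) - cover l) x\<bar>" if e: "e \<in> maxima Z" for e
  proof -
    have eZ: "e \<in> Z" using e by (auto simp: maxima_def)
    \<comment> \<open>On the tile of a maximal event, being covered by older layers is the same as
      having been reset before. One direction uses maximality and uniqueness, the other that
      \<open>Z\<close> contains its causal past.\<close>
    have "tile (lab e) - cover l = tile (lab e) - {\<eta>. shift_act \<Gamma> \<eta> x \<in> reset (fst e)}"
    proof -
      have "\<eta> \<in> cover l \<longleftrightarrow> shift_act \<Gamma> \<eta> x \<in> reset (fst e)" if \<eta>: "\<eta> \<in> tile (lab e)" for \<eta>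
      proof -
        have "\<eta> \<in> carrier \<Gamma>" using \<eta> tile_carrier[OF event_lab[OF ev[OF eZ]]] by auto
        note iff = mem_reset_iff[OF this]
        show ?thesis
        proof
          assume "\<eta> \<in> cover l"
          then obtain e' where e': "e' \<in> Z" "e' \<notin> maxima Z" "\<eta> \<in> tile (lab e')"
            by (auto simp: l(3) Z'_def)
          then have meet: "tile (lab e) \<inter> tile (lab e') \<noteq> {}" using \<eta> by auto
          have "\<not> fst e < fst e'" using maxD[OF e e'(1)] meet by auto
          moreover have "fst e \<noteq> fst e'" using event_unique[OF ev ev _ meet] eZ e' e by auto
          ultimately show "shift_act \<Gamma> \<eta> x \<in> reset (fst e)"
            unfolding iff using ev[OF e'(1)] e'(3) by (intro exI[of _ e']) auto
        next
          assume "shift_act \<Gamma> \<eta> x \<in> reset (fst e)"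
          then obtain e' where e': "event e'" "fst e' < fst e" "\<eta> \<in> tile (lab e')" using iff by auto
          then have meet: "tile (lab e') \<inter> tile (lab e) \<noteq> {}" using \<eta> by auto
          have "e' \<in> Z" using past[OF eZ e'(1,2) meet] .
          moreover have "e' \<notin> maxima Z" using maxD[of e' e] eZ e' meet by auto
          ultimately show "\<eta> \<in> cover l" using e' by (auto simp: l(3) Z'_def)
        qed
      qed
      then show ?thesis by auto
    qed
    then show ?thesis using event_field_sum[OF ev[OF eZ]] by simp
  qed
  then have "legal (lab ` maxima Z # l) x" using dj l(2) by auto
  moreover have "cover (lab ` maxima Z # l) = (\<Union>e\<in>Z. tile (lab e))"
    using l(3) by (auto simp: Z'_def maxima_def)
  ultimately show ?case using st by blast
qed

text \<open>Take an event \<open>e0\<close> whose tile contains \<open>\<one>\<close>, and let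
  \<open>Z\<close> be its causal past, i.e. everything from which a chain of dependences leads to
  \<open>e0\<close>. Every other event of \<open>Z\<close> has a successor in \<open>Z\<close>, so
  \<open>e0\<close> is the only maximum and the history starts with one label.\<close>

lemma reset_imp_legal:
  assumes "x \<in> reset t0"
  shows "\<exists>v\<in>{v \<in> idx ` {..<t0} \<times> carrier \<Gamma>. tile v \<inter> {\<one>} \<noteq> {}}.
           \<exists>l\<in>stable_seqs (idx ` {..<t0}) t0 {v}. legal l x"
proof -
  have "shift_act \<Gamma> \<one> x \<in> reset t0" using assms x by (simp add: shift_act_one)
  then obtain e0 where e0: "event e0" "fst e0 < t0" "\<one> \<in> tile (lab e0)"
    using mem_reset_iff[OF one_closed] by auto
  define rel where "rel = {(e', e). event e' \<and> event e \<and> fst e' < fst e \<and> tile (lab e') \<inter> tile (lab e) \<noteq> {}}"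
  define Z where "Z = {e. (e, e0) \<in> rel\<^sup>*}"
  have Zev: "event e \<and> fst e \<le> fst e0" if "e \<in> Z" for e
    using that[unfolded Z_def mem_Collect_eq]
    by (induction rule: converse_rtrancl_induct) (use e0 in \<open>auto simp: rel_def\<close>)
  have "past_closed Z"
    unfolding past_closed_def
  proof (intro conjI ballI allI impI)
    fix e e' assume e: "e \<in> Z" "event e'" "fst e' < fst e" "tile (lab e') \<inter> tile (lab e) \<noteq> {}"
    then have "(e', e) \<in> rel" using Zev by (auto simp: rel_def)
    with e show "e' \<in> Z" by (auto simp: Z_def intro: converse_rtrancl_into_rtrancl)
  qed (use Zev in auto)
  moreover have "maxima Z = {e0}"
  proof
    show "maxima Z \<subseteq> {e0}"
    proof
      fix e assume e: "e \<in> maxima Z"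
      then have "(e, e0) \<in> rel\<^sup>*" by (auto simp: maxima_def Z_def)
      then show "e \<in> {e0}"
      proof (cases rule: converse_rtranclE)
        case (step e1)
        then have "e1 \<in> Z" by (simp add: Z_def)
        with e step show ?thesis by (auto simp: maxima_def rel_def)
      qed simp
    qed
    show "{e0} \<subseteq> maxima Z"
      using Zev by (force simp: maxima_def Z_def)
  qed
  moreover have "fst e < t0" if "e \<in> Z" for e using Zev[OF that] e0 by simp
  ultimately have "\<exists>l\<in>stable_seqs (idx ` {..<t0}) t0 {lab e0}. legal l x"
    using stable_seq_exists[of Z t0 "idx ` {..<t0}"] by auto
  moreover have "lab e0 \<in> {v \<in> idx ` {..<t0} \<times> carrier \<Gamma>. tile v \<inter> {\<one>} \<noteq> {}}"
    using e0 by (auto simp: lab_def event_def)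
  ultimately show ?thesis by (rule_tac bexI[of _ "lab e0"])
qed

end

section \<open>The limiting reset set\<close>

lemma prob_reset_le: "S.prob (reset k) \<le> \<theta>"
proof -
  let ?M = "idx ` {..<k}"
  let ?U = "\<Union>v\<in>{v \<in> ?M \<times> carrier \<Gamma>. tile v \<inter> {\<one>} \<noteq> {}}. \<Union>l\<in>stable_seqs ?M k {v}.
            {x \<in> space (shift_measure \<Gamma>). legal l x}"
  have "reset k \<subseteq> ?U"
  proof
    fix x assume x: "x \<in> reset k"
    then have "x \<in> space (shift_measure \<Gamma>)" using sets.sets_into_space[OF sets_reset] by auto
    with reset_imp_legal[OF this x] show "x \<in> ?U" by blast
  qed
  then have "S.prob (reset k) \<le> S.prob ?U"
    by (intro S.finite_measure_mono prob_stable_le) auto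
  also have "\<dots> \<le> \<theta>" by (rule prob_stable_le) auto
  finally show ?thesis .
qed

lemma reset_mono: "j \<le> k \<Longrightarrow> reset j \<subseteq> reset k"
  by (rule lift_Suc_mono_le[of reset]) auto

lemma good_reset_set:
  "\<exists>R\<in>sets (shift_measure \<Gamma>). S.prob R \<le> \<theta> \<and> (AE x in shift_measure \<Gamma>. \<forall>n.
     \<bar>\<Sum>\<delta>\<in>D n. if shift_act \<Gamma> \<delta> x \<in> R then 0 else \<phi> (shift_act \<Gamma> \<delta> x)\<bar> \<le> \<epsilon> * real (card (D n)))"
proof (intro bexI conjI)
  let ?R = "\<Union>k. reset k"
  show "?R \<in> sets (shift_measure \<Gamma>)" using sets_reset by auto
  have "(\<lambda>k. S.prob (reset k)) \<longlonglongrightarrow> S.prob ?R"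
    using sets_reset reset_mono
    by (intro S.finite_Lim_measure_incseq) (auto simp: incseq_def)
  then show "S.prob ?R \<le> \<theta>"
    by (rule LIMSEQ_le_const2) (auto simp: prob_reset_le)
  show "AE x in shift_measure \<Gamma>. \<forall>n.
     \<bar>\<Sum>\<delta>\<in>D n. if shift_act \<Gamma> \<delta> x \<in> ?R then 0 else \<phi> (shift_act \<Gamma> \<delta> x)\<bar> \<le> \<epsilon> * real (card (D n))"
    using A_recurrent AE_space
  proof eventually_elim
    case (elim x)
    show ?case
    proof (rule allI, rule ccontr)
      fix n
      assume neg: "\<not> \<bar>\<Sum>\<delta>\<in>D n. if shift_act \<Gamma> \<delta> x \<in> ?R then 0 else \<phi> (shift_act \<Gamma> \<delta> x)\<bar>
          \<le> \<epsilon> * real (card (D n))"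
      \<comment> \<open>Only finitely many orbit points enter the sum for \<open>n\<close>, so a
        single step suffices for all of them to reach their final status.\<close>
      have "\<exists>k. \<forall>\<delta>\<in>D n. shift_act \<Gamma> \<delta> x \<in> ?R \<longrightarrow> shift_act \<Gamma> \<delta> x \<in> reset k"
      proof -
        have "\<forall>\<delta>\<in>D n. \<exists>k. shift_act \<Gamma> \<delta> x \<in> ?R \<longrightarrow> shift_act \<Gamma> \<delta> x \<in> reset k" by auto
        then obtain m where m: "\<forall>\<delta>\<in>D n. shift_act \<Gamma> \<delta> x \<in> ?R \<longrightarrow> shift_act \<Gamma> \<delta> x \<in> reset (m \<delta>)"
          by metis
        have "m \<delta> \<le> Max (m ` D n)" if "\<delta> \<in> D n" for \<delta>
          using that D_finite by auto
        with m reset_mono show ?thesis by (intro exI[of _ "Max (m ` D n)"]) blast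
      qed
      then obtain k where k: "\<forall>\<delta>\<in>D n. shift_act \<Gamma> \<delta> x \<in> ?R \<longrightarrow> shift_act \<Gamma> \<delta> x \<in> reset k" by auto
      \<comment> \<open>By recurrence \<open>x\<close> is examined for \<open>n\<close> after its
        sum has stabilised, so failure in the limit is failure at step \<open>j\<close>.\<close>
      from elim obtain j where j: "j \<ge> k" "idx j = n" "x \<in> A j" by blast
      have eq: "shift_act \<Gamma> \<delta> x \<in> reset j \<longleftrightarrow> shift_act \<Gamma> \<delta> x \<in> ?R" if "\<delta> \<in> D n" for \<delta>
        using k that reset_mono[OF j(1)] by auto
      have "(\<Sum>\<delta>\<in>D n. if shift_act \<Gamma> \<delta> x \<in> reset j then 0 else \<phi> (shift_act \<Gamma> \<delta> x))
        = (\<Sum>\<delta>\<in>D n. if shift_act \<Gamma> \<delta> x \<in> ?R then 0 else \<phi> (shift_act \<Gamma> \<delta> x))"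
        by (intro sum.cong refl) (simp only: eq)
      then have xb: "x \<in> bad j (reset j)"
        using neg j by (auto simp: bad_def)
      have "shift_act \<Gamma> \<delta> x \<in> ?R" if "\<delta> \<in> D n" for \<delta>
      proof -
        have c: "\<delta> \<in> carrier \<Gamma>" using that D_carrier by auto
        then have "shift_act \<Gamma> (inv \<delta>) (shift_act \<Gamma> \<delta> x) = x"
          using elim by (simp add: shift_act_shift_act shift_act_one)
        then have "shift_act \<Gamma> \<delta> x \<in> reset (Suc j)"
          using xb that j c elim by (auto intro!: bexI[of _ \<delta>] shift_act_in_space)
        then show ?thesis by blast
      qed
      then have "(\<Sum>\<delta>\<in>D n. if shift_act \<Gamma> \<delta> x \<in> ?R then 0 else \<phi> (shift_act \<Gamma> \<delta> x)) = 0"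
        by (intro sum.neutral) auto
      with neg eps_pos show False by auto
    qed
  qed
qed

end

section \<open>Existence of a schedule\<close>

context reset_process
begin

text \<open>Almost every \<open>x\<close> has \<open>x \<gamma> \<noteq> x \<one>\<close> for all \<open>\<gamma> \<noteq> \<one>\<close>, so rational intervals around \<open>x \<one>\<close> separate the
  points of an orbit; the dummy index \<open>m\<close> makes every choice recur infinitely often.\<close>

lemma schedule_exists:
  "\<exists>idx A. scheduled_reset_process \<Gamma> \<phi> D \<epsilon> t c \<theta> idx A"
proof -
  define T where "T = (\<lambda>n. {\<gamma> \<in> carrier \<Gamma>. \<gamma> \<noteq> \<one> \<and> tile (n, \<gamma>) \<inter> tile (n, \<one>) \<noteq> {}})"
  define B where "B = (\<lambda>(n::nat, a::rat, b::rat, m::nat). {x \<in> space (shift_measure \<Gamma>).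
      of_rat a < x \<one> \<and> x \<one> < of_rat b \<and> (\<forall>\<gamma>\<in>T n. \<not> (of_rat a < x \<gamma> \<and> x \<gamma> < of_rat b))})"
  define idx where "idx = (\<lambda>k. fst (from_nat k :: nat \<times> rat \<times> rat \<times> nat))"
  define A where "A = (\<lambda>k. B (from_nat k))"
  have T_finite: "finite (T n)" for n
  proof -
    have "finite {u \<in> {n} \<times> carrier \<Gamma>. tile u \<inter> tile (n, \<one>) \<noteq> {}}"
      using tile_carrier[of "(n, \<one>)"] finite_tile by (intro tiles_meeting) auto
    then have "finite (snd ` {u \<in> {n} \<times> carrier \<Gamma>. tile u \<inter> tile (n, \<one>) \<noteq> {}})" by simp
    then show ?thesis by (rule finite_subset[rotated]) (force simp: T_def)
  qed
  note coord [measurable] = measurable_coordinate(2)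
  have "scheduled_reset_process_axioms \<Gamma> D idx A"
  proof
    fix k
    obtain n a b m where k: "from_nat k = (n::nat, a::rat, b::rat, m::nat)" by (cases "from_nat k :: nat \<times> rat \<times> rat \<times> nat")
    have "{x \<in> space (shift_measure \<Gamma>). \<not> (of_rat a < x \<gamma> \<and> x \<gamma> < of_rat b)} \<in> sets (shift_measure \<Gamma>)"
      if "\<gamma> \<in> T n" for \<gamma>
      using coord[of \<gamma>] that by (auto simp: T_def)
    then show "A k \<in> sets (shift_measure \<Gamma>)"
      using coord[OF one_closed] T_finite unfolding A_def k B_def
      by (auto intro!: sets.sets_Collect_conj sets.sets_Collect_finite_All borel_measurable_less borel_measurable_const)
    fix x \<gamma>
    assume x: "x \<in> A k" "\<gamma> \<in> carrier \<Gamma>" "shift_act \<Gamma> \<gamma> x \<in> A k" "tile (idx k, \<gamma>) \<inter> tile (idx k, \<one>) \<noteq> {}"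
    \<comment> \<open>The coordinate of \<open>\<gamma> \<cdot> x\<close> at \<open>\<one>\<close>
      is \<open>x \<gamma>\<close>, which \<open>B\<close> keeps out of the interval for
      \<open>\<gamma>\<close> in \<open>T n\<close>.\<close>
    have "shift_act \<Gamma> \<gamma> x \<one> = x \<gamma>" using x(2) by (simp add: shift_act_def)
    with x show "\<gamma> = \<one>"
      unfolding A_def k B_def idx_def by (auto simp: T_def)
  next
    have "AE x in shift_measure \<Gamma>. \<forall>n. \<forall>\<gamma>\<in>T n. x \<gamma> \<noteq> x \<one>"
      unfolding AE_all_countable
      by (intro allI AE_finite_allI T_finite AE_coordinates_distinct) (auto simp: T_def)
    then show "AE x in shift_measure \<Gamma>. \<forall>n k. \<exists>j\<ge>k. idx j = n \<and> x \<in> A j"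
      using AE_space
    proof eventually_elim
      case (elim x)
      show ?case
      proof (intro allI)
        fix n k
        \<comment> \<open>\<open>T n\<close> is finite, so the smallest gap works; without
          competitors any positive value will do, and 1 is taken.\<close>
        have "\<exists>e>0. \<forall>\<gamma>\<in>T n. e \<le> \<bar>x \<gamma> - x \<one>\<bar>"
        proof (cases "T n = {}")
          case False
          with elim T_finite[of n] show ?thesis
            by (intro exI[of _ "Min ((\<lambda>\<gamma>. \<bar>x \<gamma> - x \<one>\<bar>) ` T n)"]) auto
        qed (auto intro: exI[of _ 1])
        then obtain e where e: "e > 0" "\<forall>\<gamma>\<in>T n. e \<le> \<bar>x \<gamma> - x \<one>\<bar>" by auto
        obtain a where a: "x \<one> - e < of_rat a" "of_rat a < x \<one>" using of_rat_dense[of "x \<one> - e" "x \<one>"] e by auto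
        obtain b where b: "x \<one> < of_rat b" "of_rat b < x \<one> + e" using of_rat_dense[of "x \<one>" "x \<one> + e"] e by auto
        have xB: "x \<in> B (n, a, b, m)" for m
          using elim a b e unfolding B_def by fastforce
        have "infinite (range (\<lambda>m::nat. to_nat (n, a, b, m)))"
          by (rule range_inj_infinite) (auto simp: inj_on_def)
        then obtain j where "j \<ge> k" "j \<in> range (\<lambda>m::nat. to_nat (n, a, b, m))"
          unfolding infinite_nat_iff_unbounded_le by blast
        with xB show "\<exists>j\<ge>k. idx j = n \<and> x \<in> A j"
          by (intro exI[of _ j]) (auto simp: idx_def A_def)
      qed
    qed
  qed
  then show ?thesis
    using reset_process_axioms by (auto simp: scheduled_reset_process_def)
qed

lemma reset_set_exists:
  "\<exists>R\<in>sets (shift_measure \<Gamma>). S.prob R \<le> \<theta> \<and> (AE x in shift_measure \<Gamma>. \<forall>n.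
     \<bar>\<Sum>\<delta>\<in>D n. if shift_act \<Gamma> \<delta> x \<in> R then 0 else \<phi> (shift_act \<Gamma> \<delta> x)\<bar> \<le> \<epsilon> * real (card (D n)))"
proof -
  obtain idx A where "scheduled_reset_process \<Gamma> \<phi> D \<epsilon> t c \<theta> idx A"
    using schedule_exists by blast
  then interpret scheduled_reset_process \<Gamma> \<phi> D \<epsilon> t c \<theta> idx A .
  show ?thesis by (rule good_reset_set)
qed

end

section \<open>Decomposition of integrable functions\<close>

context bernoulli_shift
begin

definition admissible :: "real \<Rightarrow> (nat \<Rightarrow> 'a set) \<Rightarrow> bool" where
  "admissible C D \<longleftrightarrow> (\<forall>n. D n \<subseteq> carrier \<Gamma> \<and> finite (D n) \<and> C * ln (real n + 2) \<le> real (card (D n)))"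

text \<open>The averages are compared with the mean of \<open>f\<close> instead of that of \<open>g\<close>: this makes the notion
  additive and stable under \<open>L\<^sup>1\<close> limits, and costs only a factor of two.\<close>

definition decomposable :: "(('a \<Rightarrow> real) \<Rightarrow> complex) \<Rightarrow> bool" where
  "decomposable f \<longleftrightarrow> (\<forall>\<epsilon>>0. \<exists>C>0. \<forall>D. admissible C D \<longrightarrow>
     (\<exists>g. integrable (shift_measure \<Gamma>) g \<and> (LINT x|shift_measure \<Gamma>. cmod (f x - g x)) \<le> \<epsilon> \<and>
       (AE x in shift_measure \<Gamma>. \<forall>n. cmod (shift_average \<Gamma> (D n) g x - (LINT y|shift_measure \<Gamma>. f y)) \<le> \<epsilon>)))"

section \<open>Closure properties of decomposable functions\<close>

lemma admissible_mono: "admissible C D \<Longrightarrow> C' \<le> C \<Longrightarrow> admissible C' D"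
  unfolding admissible_def by (meson ln_ge_zero mult_right_mono order_trans le_add_same_cancel2
    of_nat_0_le_iff one_le_numeral add_increasing)

text \<open>The function \<open>g\<close> found for a nearby \<open>f'\<close> also serves
  \<open>f\<close>: the triangle inequality handles the L^1 error, and the means of \<open>f\<close>
  and \<open>f'\<close> differ by at most their L^1 distance.\<close>

lemma decomposable_approx:
  assumes f: "integrable (shift_measure \<Gamma>) f"
    and ap: "\<And>e. e > 0 \<Longrightarrow> \<exists>f'. integrable (shift_measure \<Gamma>) f' \<and> decomposable f' \<and>
       (LINT x|shift_measure \<Gamma>. cmod (f x - f' x)) \<le> e"
  shows "decomposable f"
  unfolding decomposable_def
proof (intro allI impI)
  fix \<epsilon> :: real assume "\<epsilon> > 0"
  then obtain f' where f': "integrable (shift_measure \<Gamma>) f'" "decomposable f'"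
      "(LINT x|shift_measure \<Gamma>. cmod (f x - f' x)) \<le> \<epsilon> / 2"
    using ap[of "\<epsilon> / 2"] by auto
  have E: "cmod ((LINT y|shift_measure \<Gamma>. f' y) - (LINT y|shift_measure \<Gamma>. f y)) \<le> \<epsilon> / 2"
  proof -
    have "cmod ((LINT y|shift_measure \<Gamma>. f' y) - (LINT y|shift_measure \<Gamma>. f y))
        = cmod (LINT y|shift_measure \<Gamma>. f y - f' y)"
      using f f' by (simp add: norm_minus_commute)
    also have "\<dots> \<le> (LINT x|shift_measure \<Gamma>. cmod (f x - f' x))"
      by (rule integral_norm_bound)
    finally show ?thesis using f' by simp
  qed
  obtain C where C: "C > 0" "\<And>D. admissible C D \<Longrightarrow>
     (\<exists>g. integrable (shift_measure \<Gamma>) g \<and> (LINT x|shift_measure \<Gamma>. cmod (f' x - g x)) \<le> \<epsilon> / 2 \<and>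
       (AE x in shift_measure \<Gamma>. \<forall>n. cmod (shift_average \<Gamma> (D n) g x - (LINT y|shift_measure \<Gamma>. f' y)) \<le> \<epsilon> / 2))"
    using f'(2)[unfolded decomposable_def, rule_format, of "\<epsilon> / 2"] \<open>\<epsilon> > 0\<close> by auto
  have "\<exists>g. integrable (shift_measure \<Gamma>) g \<and> (LINT x|shift_measure \<Gamma>. cmod (f x - g x)) \<le> \<epsilon> \<and>
       (AE x in shift_measure \<Gamma>. \<forall>n. cmod (shift_average \<Gamma> (D n) g x - (LINT y|shift_measure \<Gamma>. f y)) \<le> \<epsilon>)"
    if D: "admissible C D" for D
  proof -
    obtain g where g: "integrable (shift_measure \<Gamma>) g" "(LINT x|shift_measure \<Gamma>. cmod (f' x - g x)) \<le> \<epsilon> / 2"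
      "AE x in shift_measure \<Gamma>. \<forall>n. cmod (shift_average \<Gamma> (D n) g x - (LINT y|shift_measure \<Gamma>. f' y)) \<le> \<epsilon> / 2"
      using C(2)[OF D] by auto
    have "(LINT x|shift_measure \<Gamma>. cmod (f x - g x))
        \<le> (LINT x|shift_measure \<Gamma>. cmod (f x - f' x) + cmod (f' x - g x))"
      using f f' g by (intro integral_mono) (auto intro: norm_diff_triangle_le)
    also have "\<dots> = (LINT x|shift_measure \<Gamma>. cmod (f x - f' x)) + (LINT x|shift_measure \<Gamma>. cmod (f' x - g x))"
      using f f' g by (intro Bochner_Integration.integral_add) auto
    also have "\<dots> \<le> \<epsilon>" using f' g by simp
    finally have "(LINT x|shift_measure \<Gamma>. cmod (f x - g x)) \<le> \<epsilon>" .
    moreover have "AE x in shift_measure \<Gamma>. \<forall>n. cmod (shift_average \<Gamma> (D n) g x - (LINT y|shift_measure \<Gamma>. f y)) \<le> \<epsilon>"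
      using g(3)
    proof eventually_elim
      case (elim x)
      show ?case
      proof
        fix n
        show "cmod (shift_average \<Gamma> (D n) g x - (LINT y|shift_measure \<Gamma>. f y)) \<le> \<epsilon>"
          using norm_diff_triangle_le[OF elim[rule_format, of n] E] by simp
      qed
    qed
    ultimately show ?thesis using g(1) by blast
  qed
  with C(1) show "\<exists>C>0. \<forall>D. admissible C D \<longrightarrow>
     (\<exists>g. integrable (shift_measure \<Gamma>) g \<and> (LINT x|shift_measure \<Gamma>. cmod (f x - g x)) \<le> \<epsilon> \<and>
       (AE x in shift_measure \<Gamma>. \<forall>n. cmod (shift_average \<Gamma> (D n) g x - (LINT y|shift_measure \<Gamma>. f y)) \<le> \<epsilon>))"
    by blast
qed

lemma decomposable_cong:
  assumes "decomposable f'" "integrable (shift_measure \<Gamma>) f'"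
    and eq: "\<And>x. x \<in> space (shift_measure \<Gamma>) \<Longrightarrow> f x = f' x"
  shows "decomposable f"
proof (rule decomposable_approx)
  show "integrable (shift_measure \<Gamma>) f"
    using assms(2) eq by (subst Bochner_Integration.integrable_cong[OF refl eq])
  have "(LINT x|shift_measure \<Gamma>. cmod (f x - f' x)) = (LINT x|shift_measure \<Gamma>. 0)"
    by (intro Bochner_Integration.integral_cong) (auto simp: eq)
  with assms show "\<exists>f'. integrable (shift_measure \<Gamma>) f' \<and> decomposable f' \<and>
       (LINT x|shift_measure \<Gamma>. cmod (f x - f' x)) \<le> e" if "e > 0" for e
    using that by (intro exI[of _ f']) auto
qed

lemma decomposable_add:
  assumes "decomposable f1" "decomposable f2"
    and i: "integrable (shift_measure \<Gamma>) f1" "integrable (shift_measure \<Gamma>) f2"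
  shows "decomposable (\<lambda>x. f1 x + f2 x)"
  unfolding decomposable_def
proof (intro allI impI)
  fix \<epsilon> :: real assume "\<epsilon> > 0"
  then have e2: "\<epsilon> / 2 > 0" by simp
  let ?E = "\<lambda>f. LINT y|shift_measure \<Gamma>. f y"
  obtain C1 where C1: "C1 > 0" "\<And>D. admissible C1 D \<Longrightarrow>
     (\<exists>g. integrable (shift_measure \<Gamma>) g \<and> (LINT x|shift_measure \<Gamma>. cmod (f1 x - g x)) \<le> \<epsilon> / 2 \<and>
       (AE x in shift_measure \<Gamma>. \<forall>n. cmod (shift_average \<Gamma> (D n) g x - ?E f1) \<le> \<epsilon> / 2))"
    using assms(1)[unfolded decomposable_def, rule_format, OF e2] by auto
  obtain C2 where C2: "C2 > 0" "\<And>D. admissible C2 D \<Longrightarrow>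
     (\<exists>g. integrable (shift_measure \<Gamma>) g \<and> (LINT x|shift_measure \<Gamma>. cmod (f2 x - g x)) \<le> \<epsilon> / 2 \<and>
       (AE x in shift_measure \<Gamma>. \<forall>n. cmod (shift_average \<Gamma> (D n) g x - ?E f2) \<le> \<epsilon> / 2))"
    using assms(2)[unfolded decomposable_def, rule_format, OF e2] by auto
  have "\<exists>g. integrable (shift_measure \<Gamma>) g \<and> (LINT x|shift_measure \<Gamma>. cmod (f1 x + f2 x - g x)) \<le> \<epsilon> \<and>
       (AE x in shift_measure \<Gamma>. \<forall>n. cmod (shift_average \<Gamma> (D n) g x - ?E (\<lambda>x. f1 x + f2 x)) \<le> \<epsilon>)"
    if D: "admissible (max C1 C2) D" for D
  proof -
    obtain g1 where g1: "integrable (shift_measure \<Gamma>) g1" "(LINT x|shift_measure \<Gamma>. cmod (f1 x - g1 x)) \<le> \<epsilon> / 2"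
      "AE x in shift_measure \<Gamma>. \<forall>n. cmod (shift_average \<Gamma> (D n) g1 x - ?E f1) \<le> \<epsilon> / 2"
      using C1(2)[OF admissible_mono[OF D]] by auto
    obtain g2 where g2: "integrable (shift_measure \<Gamma>) g2" "(LINT x|shift_measure \<Gamma>. cmod (f2 x - g2 x)) \<le> \<epsilon> / 2"
      "AE x in shift_measure \<Gamma>. \<forall>n. cmod (shift_average \<Gamma> (D n) g2 x - ?E f2) \<le> \<epsilon> / 2"
      using C2(2)[OF admissible_mono[OF D]] by auto
    have "(LINT x|shift_measure \<Gamma>. cmod (f1 x + f2 x - (g1 x + g2 x)))
        \<le> (LINT x|shift_measure \<Gamma>. cmod (f1 x - g1 x) + cmod (f2 x - g2 x))"
      using i g1 g2 by (intro integral_mono) (auto intro: norm_diff_triangle_ineq)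
    also have "\<dots> = (LINT x|shift_measure \<Gamma>. cmod (f1 x - g1 x)) + (LINT x|shift_measure \<Gamma>. cmod (f2 x - g2 x))"
      using i g1 g2 by (intro Bochner_Integration.integral_add) auto
    also have "\<dots> \<le> \<epsilon>" using g1 g2 by simp
    finally have "(LINT x|shift_measure \<Gamma>. cmod (f1 x + f2 x - (g1 x + g2 x))) \<le> \<epsilon>" .
    moreover have "AE x in shift_measure \<Gamma>. \<forall>n. cmod (shift_average \<Gamma> (D n) (\<lambda>x. g1 x + g2 x) x - ?E (\<lambda>x. f1 x + f2 x)) \<le> \<epsilon>"
      using g1(3) g2(3)
    proof eventually_elim
      case (elim x)
      show ?case
      proof
        fix n
        have "shift_average \<Gamma> (D n) (\<lambda>x. g1 x + g2 x) x = shift_average \<Gamma> (D n) g1 x + shift_average \<Gamma> (D n) g2 x"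
          by (simp add: shift_average_def sum.distrib add_divide_distrib)
        moreover have "?E (\<lambda>x. f1 x + f2 x) = ?E f1 + ?E f2"
          using i by simp
        ultimately show "cmod (shift_average \<Gamma> (D n) (\<lambda>x. g1 x + g2 x) x - ?E (\<lambda>x. f1 x + f2 x)) \<le> \<epsilon>"
          using norm_diff_triangle_ineq[of "shift_average \<Gamma> (D n) g1 x" "shift_average \<Gamma> (D n) g2 x" "?E f1" "?E f2"]
            elim[rule_format, of n] by (smt (verit) field_sum_of_halves)
      qed
    qed
    ultimately show ?thesis using g1(1) g2(1) by (intro exI[of _ "\<lambda>x. g1 x + g2 x"]) auto
  qed
  with C1(1) show "\<exists>C>0. \<forall>D. admissible C D \<longrightarrow>
     (\<exists>g. integrable (shift_measure \<Gamma>) g \<and> (LINT x|shift_measure \<Gamma>. cmod (f1 x + f2 x - g x)) \<le> \<epsilon> \<and>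
       (AE x in shift_measure \<Gamma>. \<forall>n. cmod (shift_average \<Gamma> (D n) g x - ?E (\<lambda>x. f1 x + f2 x)) \<le> \<epsilon>))"
    by (intro exI[of _ "max C1 C2"]) auto
qed

lemma decomposable_cmult:
  assumes "decomposable f" and i: "integrable (shift_measure \<Gamma>) f"
  shows "decomposable (\<lambda>x. a * f x)"
  unfolding decomposable_def
proof (intro allI impI)
  fix \<epsilon> :: real assume "\<epsilon> > 0"
  let ?E = "\<lambda>f. LINT y|shift_measure \<Gamma>. f y"
  \<comment> \<open>The summand 1 covers \<open>a = 0\<close>.\<close>
  define e where "e = \<epsilon> / (cmod a + 1)"
  have "e > 0" using \<open>\<epsilon> > 0\<close> by (simp add: e_def add_nonneg_pos)
  have ae: "cmod a * e \<le> \<epsilon>"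
    using \<open>\<epsilon> > 0\<close> by (simp add: e_def divide_simps add_nonneg_pos mult_mono)
  obtain C where C: "C > 0" "\<And>D. admissible C D \<Longrightarrow>
     (\<exists>g. integrable (shift_measure \<Gamma>) g \<and> (LINT x|shift_measure \<Gamma>. cmod (f x - g x)) \<le> e \<and>
       (AE x in shift_measure \<Gamma>. \<forall>n. cmod (shift_average \<Gamma> (D n) g x - ?E f) \<le> e))"
    using assms(1)[unfolded decomposable_def, rule_format, OF \<open>e > 0\<close>] by auto
  have "\<exists>g. integrable (shift_measure \<Gamma>) g \<and> (LINT x|shift_measure \<Gamma>. cmod (a * f x - g x)) \<le> \<epsilon> \<and>
       (AE x in shift_measure \<Gamma>. \<forall>n. cmod (shift_average \<Gamma> (D n) g x - ?E (\<lambda>x. a * f x)) \<le> \<epsilon>)"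
    if D: "admissible C D" for D
  proof -
    obtain g where g: "integrable (shift_measure \<Gamma>) g" "(LINT x|shift_measure \<Gamma>. cmod (f x - g x)) \<le> e"
      "AE x in shift_measure \<Gamma>. \<forall>n. cmod (shift_average \<Gamma> (D n) g x - ?E f) \<le> e"
      using C(2)[OF D] by auto
    have "(LINT x|shift_measure \<Gamma>. cmod (a * f x - a * g x)) = cmod a * (LINT x|shift_measure \<Gamma>. cmod (f x - g x))"
      by (simp add: norm_mult flip: right_diff_distrib)
    also have "\<dots> \<le> cmod a * e" using g by (intro mult_left_mono) auto
    finally have "(LINT x|shift_measure \<Gamma>. cmod (a * f x - a * g x)) \<le> \<epsilon>" using ae by simp
    moreover have "AE x in shift_measure \<Gamma>. \<forall>n. cmod (shift_average \<Gamma> (D n) (\<lambda>x. a * g x) x - ?E (\<lambda>x. a * f x)) \<le> \<epsilon>"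
      using g(3)
    proof eventually_elim
      case (elim x)
      show ?case
      proof
        fix n
        have "shift_average \<Gamma> (D n) (\<lambda>x. a * g x) x - ?E (\<lambda>x. a * f x) = a * (shift_average \<Gamma> (D n) g x - ?E f)"
          by (simp add: shift_average_def sum_distrib_left right_diff_distrib)
        moreover have "cmod a * cmod (shift_average \<Gamma> (D n) g x - ?E f) \<le> cmod a * e"
          using elim by (intro mult_left_mono) auto
        ultimately show "cmod (shift_average \<Gamma> (D n) (\<lambda>x. a * g x) x - ?E (\<lambda>x. a * f x)) \<le> \<epsilon>"
          using ae by (simp add: norm_mult)
      qed
    qed
    ultimately show ?thesis using g(1) by (intro exI[of _ "\<lambda>x. a * g x"]) auto
  qed
  with C(1) show "\<exists>C>0. \<forall>D. admissible C D \<longrightarrow>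
     (\<exists>g. integrable (shift_measure \<Gamma>) g \<and> (LINT x|shift_measure \<Gamma>. cmod (a * f x - g x)) \<le> \<epsilon> \<and>
       (AE x in shift_measure \<Gamma>. \<forall>n. cmod (shift_average \<Gamma> (D n) g x - ?E (\<lambda>x. a * f x)) \<le> \<epsilon>))"
    by blast
qed

text \<open>The reset process is run on the centred function. Resetting to 0 means replacing
  \<open>f\<close> by its mean, which changes it by at most 1 and only on \<open>R\<close>, so the
  L^1 error is at most the probability of \<open>R\<close>.\<close>

lemma decomposable_local:
  fixes \<psi> :: "('a \<Rightarrow> real) \<Rightarrow> real"
  assumes F: "finite F" "F \<subseteq> carrier \<Gamma>"
    and m [measurable]: "\<psi> \<in> borel_measurable (PiM F (\<lambda>_. unit_interval_measure))"
    and b: "\<And>z. 0 \<le> \<psi> z \<and> \<psi> z \<le> 1"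
  shows "decomposable (\<lambda>x. complex_of_real (\<psi> (restrict x F)))"
  unfolding decomposable_def
proof (intro allI impI)
  fix \<epsilon> :: real assume e: "\<epsilon> > 0"
  have mr: "(\<lambda>x. restrict x F) \<in> measurable (shift_measure \<Gamma>) (PiM F (\<lambda>_. unit_interval_measure))"
    unfolding shift_measure_def using F by (rule_tac measurable_restrict_subset) auto
  have fm [measurable]: "(\<lambda>x. \<psi> (restrict x F)) \<in> borel_measurable (shift_measure \<Gamma>)"
    using measurable_compose[OF mr m] .
  have fi: "integrable (shift_measure \<Gamma>) (\<lambda>x. \<psi> (restrict x F))"
    using b by (intro S.integrable_const_bound[of _ 1]) auto
  define \<mu> where "\<mu> = (LINT x|shift_measure \<Gamma>. \<psi> (restrict x F))"
  have \<mu>: "0 \<le> \<mu>" "\<mu> \<le> 1"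
    using b fi unfolding \<mu>_def by (auto intro!: integral_nonneg S.integral_le_const)
  define \<psi>' where "\<psi>' = (\<lambda>z. \<psi> z - \<mu>)"
  define \<phi> where "\<phi> = (\<lambda>x. \<psi>' (restrict x F))"
  have m' [measurable]: "\<psi>' \<in> borel_measurable (PiM F (\<lambda>_. unit_interval_measure))"
    unfolding \<psi>'_def by measurable
  have b': "\<bar>\<psi>' z\<bar> \<le> 1" for z using b[of z] \<mu> by (auto simp: \<psi>'_def)
  have mean': "(LINT x|shift_measure \<Gamma>. \<psi>' (restrict x F)) = 0"
    using fi by (simp add: \<psi>'_def \<mu>_def S.prob_space)
  have \<phi>m [measurable]: "\<phi> \<in> borel_measurable (shift_measure \<Gamma>)"
    unfolding \<phi>_def \<psi>'_def by measurable
  define k where "k = (card F)\<^sup>2 + 1"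
  define K where "K = (real k)\<^sup>2 / 2"
  have "k > 0" by (simp add: k_def)
  then have K: "K > 0" by (simp add: K_def)
  \<comment> \<open>This \<open>t\<close> maximises the rate
    \<open>t * \<epsilon> - K * t\<^sup>2\<close> and gives
    \<open>c = \<epsilon>\<^sup>2 / (4 * K)\<close>.\<close>
  define t where "t = \<epsilon> / (2 * K)"
  define c where "c = t * \<epsilon> - K * t\<^sup>2"
  have t: "t > 0" using e K by (simp add: t_def)
  have "c = \<epsilon>\<^sup>2 / (4 * K)"
    using K by (simp add: c_def t_def power2_eq_square field_simps)
  then have c: "c > 0" using e K by simp
  \<comment> \<open>The first bound controls the L^1 error, the second is the Local Lemma condition
    \<open>\<theta>_le\<close>.\<close>
  define \<theta> where "\<theta> = min \<epsilon> (c / 2)"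
  have \<theta>: "\<theta> > 0" using e c by (simp add: \<theta>_def)
  obtain C where C: "0 < C" "\<And>d M. (\<And>n. C * ln (real n + 2) \<le> d n) \<Longrightarrow> finite M \<Longrightarrow>
      (\<Sum>m\<in>M. d m * (2 * exp (- (c / 2) * d m))) \<le> \<theta>"
    using log_growth_weights_small[OF c \<theta>] by metis
  have "\<exists>g. integrable (shift_measure \<Gamma>) g \<and>
       (LINT x|shift_measure \<Gamma>. cmod (complex_of_real (\<psi> (restrict x F)) - g x)) \<le> \<epsilon> \<and>
       (AE x in shift_measure \<Gamma>. \<forall>n. cmod (shift_average \<Gamma> (D n) g x
          - (LINT y|shift_measure \<Gamma>. complex_of_real (\<psi> (restrict y F)))) \<le> \<epsilon>)"
    if D: "admissible C D" for D
  proof -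
    have D': "D n \<subseteq> carrier \<Gamma>" "finite (D n)" "C * ln (real n + 2) \<le> real (card (D n))" for n
      using D by (auto simp: admissible_def)
    \<comment> \<open>Since \<open>ln (n + 2)\<close> is positive already at \<open>n = 0\<close>,
      no \<open>D n\<close> is empty and the averages are genuine quotients.\<close>
    have Dpos: "0 < card (D n)" for n
    proof -
      have "0 < C * ln (real n + 2)" using C by simp
      with D'(3)[of n] show ?thesis by linarith
    qed
    interpret reset_process \<Gamma> \<phi> D \<epsilon> t c \<theta>
    proof
      fix Y :: "'a set" and s :: "'a \<Rightarrow> real"
      assume Y: "finite Y" "Y \<subseteq> carrier \<Gamma>" and s: "\<And>y. \<bar>s y\<bar> = 1"
      have "(\<integral>\<^sup>+x. ennreal (exp (t * (\<Sum>y\<in>Y. s y * \<psi>' (restrict (shift_act \<Gamma> y x) F)))) \<partial>shift_measure \<Gamma>)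
          \<le> ennreal (exp ((real k)\<^sup>2 / 2 * t\<^sup>2 * real (card Y)))"
        by (rule mgf_local[OF F m' b' mean' Y s t k_def])
      then show "(\<integral>\<^sup>+x. ennreal (exp (t * (\<Sum>y\<in>Y. s y * \<phi> (shift_act \<Gamma> y x)))) \<partial>shift_measure \<Gamma>)
        \<le> ennreal (exp ((t * \<epsilon> - c) * real (card Y)))"
        by (simp add: \<phi>_def c_def K_def)
    next
      show "c \<le> t * \<epsilon>" using K by (simp add: c_def)
      show "(\<Sum>m\<in>M. real (card (D m)) * (2 * exp (- (c / 2) * real (card (D m))))) \<le> \<theta>" if "finite M" for M
        using C(2)[of "\<lambda>n. real (card (D n))" M] D' that by simp
      show "\<theta> \<le> c / 2" by (simp add: \<theta>_def)
    qed (fact e t c D' \<phi>m)+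
    obtain R where R [measurable]: "R \<in> sets (shift_measure \<Gamma>)" and "S.prob R \<le> \<theta>"
      and avg: "AE x in shift_measure \<Gamma>. \<forall>n.
       \<bar>\<Sum>\<delta>\<in>D n. if shift_act \<Gamma> \<delta> x \<in> R then 0 else \<phi> (shift_act \<Gamma> \<delta> x)\<bar> \<le> \<epsilon> * real (card (D n))"
      using reset_set_exists by blast
    define g where "g = (\<lambda>x. complex_of_real ((if x \<in> R then 0 else \<phi> x) + \<mu>))"
    have gi: "integrable (shift_measure \<Gamma>) g"
    proof (rule S.integrable_const_bound[of _ 2])
      have "\<bar>\<phi> x\<bar> \<le> 1" for x using b' by (simp add: \<phi>_def)
      then have "\<bar>(if x \<in> R then 0 else \<phi> x) + \<mu>\<bar> \<le> 2" for x
        using \<mu> by (smt (verit))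
      then show "AE x in shift_measure \<Gamma>. cmod (g x) \<le> 2"
        unfolding g_def norm_of_real by simp
      show "g \<in> borel_measurable (shift_measure \<Gamma>)" unfolding g_def by measurable
    qed
    have "(LINT x|shift_measure \<Gamma>. cmod (complex_of_real (\<psi> (restrict x F)) - g x))
        \<le> (LINT x|shift_measure \<Gamma>. indicator R x)"
    proof (rule integral_mono)
      show "integrable (shift_measure \<Gamma>) (\<lambda>x. cmod (complex_of_real (\<psi> (restrict x F)) - g x))"
        using fi gi by (intro integrable_norm Bochner_Integration.integrable_diff) auto
      fix x
      have "complex_of_real (\<psi> (restrict x F)) - g x = complex_of_real (if x \<in> R then \<phi> x else 0)"
        by (simp add: g_def \<phi>_def \<psi>'_def)
      then show "cmod (complex_of_real (\<psi> (restrict x F)) - g x) \<le> indicator R x"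
        using b' by (simp add: \<phi>_def indicator_def)
    qed (intro integrable_real_indicator, simp_all add: S.emeasure_finite less_top[symmetric])
    also have "\<dots> \<le> \<epsilon>" using \<open>S.prob R \<le> \<theta>\<close> by (simp add: \<theta>_def)
    finally have h: "(LINT x|shift_measure \<Gamma>. cmod (complex_of_real (\<psi> (restrict x F)) - g x)) \<le> \<epsilon>" .
    have "AE x in shift_measure \<Gamma>. \<forall>n. cmod (shift_average \<Gamma> (D n) g x
          - (LINT y|shift_measure \<Gamma>. complex_of_real (\<psi> (restrict y F)))) \<le> \<epsilon>"
      using avg
    proof eventually_elim
      case (elim x)
      show ?case
      proof
        fix n
        let ?s = "\<Sum>\<delta>\<in>D n. if shift_act \<Gamma> \<delta> x \<in> R then 0 else \<phi> (shift_act \<Gamma> \<delta> x)"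
        have "shift_average \<Gamma> (D n) g x = complex_of_real ((?s + real (card (D n)) * \<mu>) / real (card (D n)))"
          unfolding shift_average_def g_def of_real_sum[symmetric] sum.distrib by simp
        also have "(?s + real (card (D n)) * \<mu>) / real (card (D n)) = ?s / real (card (D n)) + \<mu>"
          using Dpos[of n] by (simp add: add_divide_distrib)
        finally have "shift_average \<Gamma> (D n) g x
          - (LINT y|shift_measure \<Gamma>. complex_of_real (\<psi> (restrict y F))) = complex_of_real (?s / real (card (D n)))"
          by (simp add: \<mu>_def)
        then have "cmod (shift_average \<Gamma> (D n) g x
          - (LINT y|shift_measure \<Gamma>. complex_of_real (\<psi> (restrict y F)))) = \<bar>?s\<bar> / real (card (D n))"
          by (simp only: norm_of_real) simp
        also have "\<dots> \<le> \<epsilon>"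
          using elim[rule_format, of n] Dpos[of n] by (simp add: divide_simps)
        finally show "cmod (shift_average \<Gamma> (D n) g x
          - (LINT y|shift_measure \<Gamma>. complex_of_real (\<psi> (restrict y F)))) \<le> \<epsilon>" .
      qed
    qed
    with gi h show ?thesis by blast
  qed
  with C(1) show "\<exists>C>0. \<forall>D. admissible C D \<longrightarrow> (\<exists>g. integrable (shift_measure \<Gamma>) g \<and>
       (LINT x|shift_measure \<Gamma>. cmod (complex_of_real (\<psi> (restrict x F)) - g x)) \<le> \<epsilon> \<and>
       (AE x in shift_measure \<Gamma>. \<forall>n. cmod (shift_average \<Gamma> (D n) g x
          - (LINT y|shift_measure \<Gamma>. complex_of_real (\<psi> (restrict y F)))) \<le> \<epsilon>))"
    by blast
qed

section \<open>Extension from local functions to all of L^1\<close>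

lemma integrable_complex_indicator:
  "B \<in> sets (shift_measure \<Gamma>) \<Longrightarrow> integrable (shift_measure \<Gamma>) (\<lambda>x. complex_of_real (indicator B x))"
  by (intro integrable_of_real integrable_real_indicator) (auto simp: S.emeasure_finite less_top[symmetric])

text \<open>A Dynkin system argument. Finite-dimensional boxes generate the sigma-algebra and have
  local indicators; complements and finite disjoint unions follow by linearity, and countable ones
  by L^1 approximation.\<close>

lemma decomposable_indicator:
  assumes "B \<in> sets (shift_measure \<Gamma>)"
  shows "decomposable (\<lambda>x. complex_of_real (indicator B x))"
proof -
  let ?I = "carrier \<Gamma>" and ?U = "\<lambda>_. unit_interval_measure"
  have sp: "(\<Pi>\<^sub>E i\<in>?I. space (?U i)) = space (shift_measure \<Gamma>)"
    by (simp add: shift_measure_def space_PiM)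
  have sig: "sigma_sets (\<Pi>\<^sub>E i\<in>?I. space (?U i)) (prod_algebra ?I ?U) = sets (shift_measure \<Gamma>)"
    by (simp add: shift_measure_def sets_PiM)
  have const: "decomposable (\<lambda>x. complex_of_real a)" if "0 \<le> a" "a \<le> 1" for a
    using decomposable_local[of "{}" "\<lambda>_. a"] that by simp
  have "B \<in> sigma_sets (\<Pi>\<^sub>E i\<in>?I. space (?U i)) (prod_algebra ?I ?U)"
    using assms sig by simp
  then show ?thesis
  proof (induction rule: sigma_sets_induct_disjoint[OF Int_stable_prod_algebra prod_algebra_sets_into_space,
        consumes 1, case_names basic empty compl union])
    case (basic A)
    then obtain J E where J: "A = prod_emb ?I ?U J (Pi\<^sub>E J E)" "finite J" "J \<subseteq> ?I"
      "\<And>i. i \<in> J \<Longrightarrow> E i \<in> sets unit_interval_measure"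
      by (rule prod_algebraE) auto
    have A: "A \<in> sets (shift_measure \<Gamma>)" using basic sig by (auto intro: sigma_sets.Basic)
    let ?\<psi> = "\<lambda>z. \<Prod>i\<in>J. indicator (E i) (z i) :: real"
    have dec: "decomposable (\<lambda>x. complex_of_real (?\<psi> (restrict x J)))"
    proof (rule decomposable_local[where \<psi> = ?\<psi>, OF J(2,3)])
      show "?\<psi> \<in> borel_measurable (Pi\<^sub>M J (\<lambda>_. unit_interval_measure))"
        using J(4) by (intro borel_measurable_prod measurable_compose[OF measurable_component_singleton
             borel_measurable_indicator]) auto
      show "0 \<le> ?\<psi> z \<and> ?\<psi> z \<le> 1" for z
        by (auto intro!: prod_nonneg prod_le_1)
    qed
    have eq: "complex_of_real (indicator A x) = complex_of_real (?\<psi> (restrict x J))"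
      if "x \<in> space (shift_measure \<Gamma>)" for x
    proof -
      have "x \<in> A \<longleftrightarrow> (\<forall>i\<in>J. x i \<in> E i)"
        using that J by (auto simp: prod_emb_def shift_measure_def space_PiM)
      moreover have "?\<psi> (restrict x J) = (if \<forall>i\<in>J. x i \<in> E i then 1 else 0)"
        using J(2) by (auto simp: indicator_def intro!: prod_zero)
      ultimately show ?thesis by (simp add: indicator_def)
    qed
    have "integrable (shift_measure \<Gamma>) (\<lambda>x. complex_of_real (?\<psi> (restrict x J)))"
      by (rule iffD1[OF Bochner_Integration.integrable_cong[OF refl eq] integrable_complex_indicator[OF A]])
    from decomposable_cong[OF dec this eq] show ?case .
  next
    case empty
    show ?case using const[of 0] by simp
  next
    case (compl A)
    have A: "A \<in> sets (shift_measure \<Gamma>)" using compl sig by auto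
    have "decomposable (\<lambda>x. complex_of_real 1 + (-1) * complex_of_real (indicator A x))"
      by (intro decomposable_add const decomposable_cmult compl.IH integrable_mult_right
           integrable_complex_indicator A) auto
    then show ?case
      by (rule decomposable_cong)
        (auto simp: sp indicator_def intro!: Bochner_Integration.integrable_diff
           integrable_complex_indicator[OF A, unfolded indicator_def])
  next
    case (union A)
    have A: "A i \<in> sets (shift_measure \<Gamma>)" for i using union sig by auto
    have fin: "decomposable (\<lambda>x. complex_of_real (indicator (\<Union>i<n. A i) x))" for n
    proof (induction n)
      case 0
      show ?case using const[of 0] by simp
    next
      case (Suc n)
      have "A i \<inter> A n = {}" if "i < n" for i
        using that disjoint_family_onD[OF union.hyps(1), of i n] by simp
      then have "(\<Union>i<n. A i) \<inter> A n = {}" by blast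
      then have "complex_of_real (indicator (\<Union>i<Suc n. A i) x) =
          complex_of_real (indicator (\<Union>i<n. A i) x) + complex_of_real (indicator (A n) x)" for x
        by (auto simp: indicator_def lessThan_Suc)
      moreover have "decomposable (\<lambda>x. complex_of_real (indicator (\<Union>i<n. A i) x) + complex_of_real (indicator (A n) x))"
        using A by (intro decomposable_add Suc.IH union.IH integrable_complex_indicator) auto
      ultimately show ?case by simp
    qed
    have Am: "(\<Union>i<n. A i) \<in> sets (shift_measure \<Gamma>)" "(\<Union>i. A i) \<in> sets (shift_measure \<Gamma>)" for n
      using A by auto
    show ?case
    proof (rule decomposable_approx)
      show "integrable (shift_measure \<Gamma>) (\<lambda>x. complex_of_real (indicator (\<Union>i. A i) x))"
        by (rule integrable_complex_indicator[OF Am(2)])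
      fix e :: real assume "e > 0"
      have "(\<lambda>n. S.prob (\<Union>i<n. A i)) \<longlonglongrightarrow> S.prob (\<Union>n. \<Union>i<n. A i)"
      proof (rule S.finite_Lim_measure_incseq)
        show "incseq (\<lambda>n. \<Union>i<n. A i)"
          by (intro monoI UN_mono) auto
      qed (use Am in auto)
      moreover have "(\<Union>n. \<Union>i<n. A i) = (\<Union>i. A i)"
        using lessI by blast
      ultimately have "eventually (\<lambda>n. S.prob (\<Union>i. A i) - e < S.prob (\<Union>i<n. A i)) sequentially"
        using \<open>e > 0\<close> by (intro order_tendstoD(1)) auto
      then obtain n where n: "S.prob (\<Union>i. A i) - e < S.prob (\<Union>i<n. A i)"
        by (auto simp: eventually_sequentially)
      have "(LINT x|shift_measure \<Gamma>. cmod (complex_of_real (indicator (\<Union>i. A i) x) - complex_of_real (indicator (\<Union>i<n. A i) x)))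
          = (LINT x|shift_measure \<Gamma>. indicator ((\<Union>i. A i) - (\<Union>i<n. A i)) x)"
        by (intro Bochner_Integration.integral_cong) (auto simp: indicator_def)
      also have "\<dots> = S.prob ((\<Union>i. A i) - (\<Union>i<n. A i))"
        using Am by (subst Bochner_Integration.integral_indicator) (auto intro!: arg_cong[where f = S.prob] dest: sets.sets_into_space)
      also have "\<dots> = S.prob (\<Union>i. A i) - S.prob (\<Union>i<n. A i)"
        using Am by (intro S.finite_measure_Diff) auto
      finally show "\<exists>f'. integrable (shift_measure \<Gamma>) f' \<and> decomposable f' \<and>
           (LINT x|shift_measure \<Gamma>. cmod (complex_of_real (indicator (\<Union>i. A i) x) - f' x)) \<le> e"
        using n fin[of n] integrable_complex_indicator[OF Am(1)[of n]]
        by (intro exI[of _ "\<lambda>x. complex_of_real (indicator (\<Union>i<n. A i) x)"]) auto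
    qed
  qed
qed

text \<open>Linearity passes from indicators to simple functions, and closure under L^1
  approximation gives the rest.\<close>

lemma integrable_imp_decomposable:
  assumes "integrable (shift_measure \<Gamma>) f"
  shows "decomposable f"
  using assms
proof (induction rule: integrable_induct)
  case (base A c)
  have "decomposable (\<lambda>x. c * complex_of_real (indicator A x))"
    by (intro decomposable_cmult decomposable_indicator integrable_complex_indicator base)
  then show ?case by (simp add: scaleR_conv_of_real mult.commute)
next
  case (add f g)
  then show ?case by (intro decomposable_add)
next
  case (lim f s)
  have [measurable]: "f \<in> borel_measurable (shift_measure \<Gamma>)" "s i \<in> borel_measurable (shift_measure \<Gamma>)" for i
    using lim by auto
  show ?case
  proof (rule decomposable_approx)
    show "integrable (shift_measure \<Gamma>) f" by fact
    \<comment> \<open>The induction supplies \<open>cmod (s i x) \<le> 2 * cmod (f x)\<close>, hence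
      the dominating function \<open>3 * cmod (f x)\<close>.\<close>
    have "(\<lambda>i. LINT x|shift_measure \<Gamma>. cmod (f x - s i x)) \<longlonglongrightarrow> (LINT x|shift_measure \<Gamma>. 0)"
    proof (rule integral_dominated_convergence[where w = "\<lambda>x. 3 * cmod (f x)"])
      show "integrable (shift_measure \<Gamma>) (\<lambda>x. 3 * cmod (f x))"
        using lim by auto
      show "AE x in shift_measure \<Gamma>. (\<lambda>i. cmod (f x - s i x)) \<longlonglongrightarrow> 0"
      proof (rule AE_I2)
        fix x assume "x \<in> space (shift_measure \<Gamma>)"
        then have "(\<lambda>i. s i x) \<longlonglongrightarrow> f x" using lim by blast
        then have "(\<lambda>i. f x - s i x) \<longlonglongrightarrow> f x - f x"
          by (intro tendsto_diff tendsto_const)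
        then show "(\<lambda>i. cmod (f x - s i x)) \<longlonglongrightarrow> 0"
          using tendsto_norm_zero by force
      qed
      show "AE x in shift_measure \<Gamma>. norm (cmod (f x - s i x)) \<le> 3 * cmod (f x)" for i
      proof (rule AE_I2)
        fix x assume "x \<in> space (shift_measure \<Gamma>)"
        then have "cmod (s i x) \<le> 2 * cmod (f x)" using lim by blast
        then show "norm (cmod (f x - s i x)) \<le> 3 * cmod (f x)"
          using norm_triangle_ineq4[of "f x" "s i x"] by simp
      qed
    qed auto
    then have lim0: "(\<lambda>i. LINT x|shift_measure \<Gamma>. cmod (f x - s i x)) \<longlonglongrightarrow> 0" by simp
    fix e :: real assume "e > 0"
    with lim0 have "eventually (\<lambda>i. (LINT x|shift_measure \<Gamma>. cmod (f x - s i x)) < e) sequentially"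
      by (rule order_tendstoD)
    then obtain i where "(LINT x|shift_measure \<Gamma>. cmod (f x - s i x)) < e"
      by (auto simp: eventually_sequentially)
    with lim show "\<exists>f'. integrable (shift_measure \<Gamma>) f' \<and> decomposable f' \<and>
       (LINT x|shift_measure \<Gamma>. cmod (f x - f' x)) \<le> e"
      by (intro exI[of _ "s i"]) auto
  qed
qed

end

theorem theorem2p4:
  fixes \<Gamma> :: "('a, 'b) monoid_scheme"
    and f :: "('a \<Rightarrow> real) \<Rightarrow> complex"
    and \<epsilon> :: real
  assumes "group \<Gamma>"
    and "countable (carrier \<Gamma>)"
    and "infinite (carrier \<Gamma>)"
    and "integrable (shift_measure \<Gamma>) f"
    and "\<epsilon> > 0"
  shows "\<exists>C::real. C > 0 \<and>
    (\<forall>D :: nat \<Rightarrow> 'a set.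
      (\<forall>n. D n \<subseteq> carrier \<Gamma> \<and> finite (D n) \<and> real (card (D n)) \<ge> C * ln (real n + 2)) \<longrightarrow>
      (\<exists>g h :: ('a \<Rightarrow> real) \<Rightarrow> complex.
         integrable (shift_measure \<Gamma>) g \<and>
         integrable (shift_measure \<Gamma>) h \<and>
         (AE x in shift_measure \<Gamma>. f x = g x + h x) \<and>
         (LINT x|shift_measure \<Gamma>. cmod (h x)) \<le> \<epsilon> \<and>
         (\<forall>n. disc_norm \<Gamma> (D n) g \<le> ereal \<epsilon>)))"
proof -
  interpret bernoulli_shift \<Gamma> using assms(1) by (simp add: bernoulli_shift_def)
  note f = assms(4)
  \<comment> \<open>One half is spent on the averages, the other on exchanging the mean of
    \<open>f\<close> for that of \<open>g\<close>.\<close>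
  have "\<epsilon> / 2 > 0" using assms(5) by simp
  from integrable_imp_decomposable[OF f, unfolded decomposable_def, rule_format, OF this]
  obtain C where C: "C > 0" "\<And>D. admissible C D \<Longrightarrow>
     (\<exists>g. integrable (shift_measure \<Gamma>) g \<and> (LINT x|shift_measure \<Gamma>. cmod (f x - g x)) \<le> \<epsilon> / 2 \<and>
       (AE x in shift_measure \<Gamma>. \<forall>n. cmod (shift_average \<Gamma> (D n) g x - (LINT y|shift_measure \<Gamma>. f y)) \<le> \<epsilon> / 2))"
    by blast
  show ?thesis
  proof (intro exI[of _ C] conjI C(1) allI impI)
    fix D :: "nat \<Rightarrow> 'a set"
    assume D: "\<forall>n. D n \<subseteq> carrier \<Gamma> \<and> finite (D n) \<and> real (card (D n)) \<ge> C * ln (real n + 2)"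
    then have "admissible C D" by (simp add: admissible_def)
    from C(2)[OF this] obtain g where g: "integrable (shift_measure \<Gamma>) g"
      "(LINT x|shift_measure \<Gamma>. cmod (f x - g x)) \<le> \<epsilon> / 2"
      "AE x in shift_measure \<Gamma>. \<forall>n. cmod (shift_average \<Gamma> (D n) g x - (LINT y|shift_measure \<Gamma>. f y)) \<le> \<epsilon> / 2"
      by blast
    have E: "cmod ((LINT y|shift_measure \<Gamma>. f y) - (LINT y|shift_measure \<Gamma>. g y)) \<le> \<epsilon> / 2"
    proof -
      have "cmod ((LINT y|shift_measure \<Gamma>. f y) - (LINT y|shift_measure \<Gamma>. g y))
          = cmod (LINT y|shift_measure \<Gamma>. f y - g y)"
        using f g by simp
      also have "\<dots> \<le> (LINT x|shift_measure \<Gamma>. cmod (f x - g x))"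
        by (rule integral_norm_bound)
      finally show ?thesis using g by simp
    qed
    have gm: "g \<in> borel_measurable (shift_measure \<Gamma>)" using g by auto
    have "disc_norm \<Gamma> (D n) g \<le> ereal \<epsilon>" for n
      unfolding disc_norm_def
    proof (rule esssup_I)
      have "shift_average \<Gamma> (D n) g \<in> borel_measurable (shift_measure \<Gamma>)"
        unfolding shift_average_def [abs_def] using D
        by (intro borel_measurable_divide borel_measurable_sum borel_measurable_const
            measurable_compose[OF measurable_shift_act gm]) auto
      then show "(\<lambda>x. ereal (cmod (shift_average \<Gamma> (D n) g x - (LINT y|shift_measure \<Gamma>. g y))))
          \<in> borel_measurable (shift_measure \<Gamma>)"
        by measurable
      show "AE x in shift_measure \<Gamma>. ereal (cmod (shift_average \<Gamma> (D n) g x - (LINT y|shift_measure \<Gamma>. g y))) \<le> ereal \<epsilon>"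
        using g(3)
      proof eventually_elim
        case (elim x)
        from norm_diff_triangle_le[OF elim[rule_format, of n] E] show ?case by simp
      qed
    qed
    with f g assms(5) show "\<exists>g h. integrable (shift_measure \<Gamma>) g \<and> integrable (shift_measure \<Gamma>) h \<and>
         (AE x in shift_measure \<Gamma>. f x = g x + h x) \<and>
         (LINT x|shift_measure \<Gamma>. cmod (h x)) \<le> \<epsilon> \<and> (\<forall>n. disc_norm \<Gamma> (D n) g \<le> ereal \<epsilon>)"
      by (intro exI[of _ g] exI[of _ "\<lambda>x. f x - g x"]) auto
  qed
qed

end
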